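(* Let $V=\{1,\dots,m\}$ with $m\ge 2$. For any hypergraphical source $\mathsf{Z}_V$, with hypergraph $(V,E,\xi)$ and edge variables $\mathsf{X}_e$, $e\in E$, and any partition $\mathcal{P}$ of $V$ into at least two non-empty disjoint sets, the secrecy capacity $C_{\mathrm S}(R)$ under total discussion rate $R\ge 0$ satisfies $$\alpha(\mathcal{P})\,R\ \ge\ \big[1-\alpha(\mathcal{P})\big]\big[C_{\mathrm S}(R)-H(\mathsf{G})\big],$$ where $$\alpha(\mathcal{P}):=\frac{\max_{e\in E:\,\xi(e)\ne V}\big|\{C\in\mathcal{P}\mid C\cap\xi(e)\ne\emptyset\}\big|-1}{|\mathcal{P}|-1}$$ and $\mathsf{G}:=(\mathsf{X}_e\mid e\in E,\ \xi(e)=V)$ consists of the edge variables observed by every user.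
   Context: Source and secret key agreement. $V=\{1,\dots,m\}$, $m\ge2$, is the finite set of users; $\mathsf{Z}_V=(\mathsf{Z}_i\mid i\in V)$ is a discrete memoryless multiple source with joint distribution $P_{\mathsf{Z}_V}$ and finite alphabet $\prod_{i\in V}Z_i$. For each block length $n$, each user $i\in V$ can generate a private random variable $\mathsf{U}_i$ independently, with $P_{\mathsf{U}_V}=\prod_{i\in V}P_{\mathsf{U}_i}$, and then observes privately $\mathsf{Z}_i^n$, where $\mathsf{Z}_V^n$ is an i.i.d. sequence of $n$ copies of $\mathsf{Z}_V$, independent of $\mathsf{U}_V$. Write $\tilde{\mathsf{Z}}_i:=(\mathsf{U}_i,\mathsf{Z}_i^n)$. The users discuss in public interactively in multiple rounds: in round $t=1,2,\dots$ some user $i_t\in V$ broadcasts $\mathsf{F}_t:=f_t(\mathsf{F}^{t-1},\tilde{\mathsf{Z}}_{i_t})$, a function of the previous messages $\mathsf{F}^{t-1}:=(\mathsf{F}_\tau\mid \tau<t)$ and of the private knowledge of user $i_t$. The entire discussion is $\mathsf{F}:=(\mathsf{F}_1,\mathsf{F}_2,\dots)$, with alphabet $F$. The users then recover a secret key $\mathsf{K}$, with alphabet $K$ (all quantities depend on $n$), such that, for some functions $\phi_i$, $i\in V$, $$\lim_{n\to\infty}\Pr\big(\exists i\in V,\ \mathsf{K}\ne\phi_i(\mathsf{F},\tilde{\mathsf{Z}}_i)\big)=0 \quad\text{(recoverability)},$$ $$\limsup_{n\to\infty}\tfrac1n\big[\log|K|-H(\mathsf{K}\mid\mathsf{F})\big]=0\quad\text{(secrecy)}.$$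 The secrecy capacity $C_{\mathrm S}(R)$ under total discussion rate $R\ge0$ is the maximum (supremum) achievable secret key rate $\liminf_{n\to\infty}\frac1n\log|K|$ over all such schemes satisfying $\limsup_{n\to\infty}\frac1n\log|F|\le R$. Hypergraphical source. $\mathsf{Z}_V$ is said to be hypergraphical if, for all $i\in V$, $\mathsf{Z}_i$ is equivalent up to bijection to $(\mathsf{X}_e\mid e\in E,\ i\in\xi(e))$, where $E$ is the edge set and $\xi:E\to 2^V\setminus\{\emptyset\}$ is called the edge function; the hypergraph $(V,E,\xi)$ and the edge (random) variables $\mathsf{X}_e$ define the source. Here $\mathsf{Z}'_i$ is a bijection of $\mathsf{Z}_i$ iff $H(\mathsf{Z}'_i\mid\mathsf{Z}_i)=H(\mathsf{Z}_i\mid\mathsf{Z}'_i)=0$.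
   Formalization: The edge variables X_e are assumed mutually independent (the claim fails otherwise, e.g. two users with edges {1},{2} sharing one fair bit, R=0), and α(P) is taken to be 0 when every edge equals V, where the maximum is undefined. *)

theory Defs
  imports "HOL-Probability.Probability"
begin

section \<open>Entropies of finitely-valued random variables\<close>

text \<open>
  These are the notations of the locale \<open>information_space\<close> with the probability space \<open>M\<close> and
  the base \<open>b\<close> of the logarithm made explicit.
\<close>

abbreviation ent :: "real \<Rightarrow> 'a measure \<Rightarrow> ('a \<Rightarrow> 'b) \<Rightarrow> real" where
  "ent b M X \<equiv> prob_space.entropy M b (count_space (X ` space M)) X"

abbreviation cond_ent :: "real \<Rightarrow> 'a measure \<Rightarrow> ('a \<Rightarrow> 'b) \<Rightarrow> ('a \<Rightarrow> 'c) \<Rightarrow> real" where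
  "cond_ent b M X Y \<equiv>
     prob_space.conditional_entropy M b (count_space (X ` space M)) (count_space (Y ` space M)) X Y"


section \<open>Sources\<close>

definition source_law ::
  "nat set \<Rightarrow> (nat \<Rightarrow> 'z set) \<Rightarrow> 'a measure \<Rightarrow> (nat \<Rightarrow> 'a \<Rightarrow> 'z) \<Rightarrow> (nat \<Rightarrow> 'z) measure" where
  "source_law V A M Z = distr M (\<Pi>\<^sub>M i\<in>V. count_space (A i)) (\<lambda>\<omega>. \<lambda>i\<in>V. Z i \<omega>)"

definition equiv_up_to_bij :: "real \<Rightarrow> 'a measure \<Rightarrow> ('a \<Rightarrow> 'b) \<Rightarrow> ('a \<Rightarrow> 'c) \<Rightarrow> bool" where
  "equiv_up_to_bij b M X Y \<longleftrightarrow> cond_ent b M X Y = 0 \<and> cond_ent b M Y X = 0"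

text \<open>
  The edge variables of a hypergraphical source are mutually independent. Without this requirement
  every source would be hypergraphical (take one edge \<open>{i}\<close> per user \<open>i\<close>, with edge variable
  \<open>Z i\<close>).
\<close>

definition hypergraphical ::
  "real \<Rightarrow> 'a measure \<Rightarrow> nat set \<Rightarrow> (nat \<Rightarrow> 'a \<Rightarrow> 'z) \<Rightarrow>
   'e set \<Rightarrow> ('e \<Rightarrow> nat set) \<Rightarrow> ('e \<Rightarrow> 'a \<Rightarrow> 'x) \<Rightarrow> bool" where
  "hypergraphical b M V Z E \<xi> X \<longleftrightarrow>
     finite E \<and>
     (\<forall>e\<in>E. \<xi> e \<subseteq> V \<and> \<xi> e \<noteq> {}) \<and>
     (\<forall>e\<in>E. simple_function M (X e)) \<and>
     prob_space.indep_vars M (\<lambda>_. count_space UNIV) X E \<and>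
     (\<forall>i\<in>V. equiv_up_to_bij b M (Z i) (\<lambda>\<omega>. \<lambda>e\<in>{e\<in>E. i \<in> \<xi> e}. X e \<omega>))"


section \<open>Secret key agreement by public discussion\<close>

text \<open>
  A scheme for one block length \<open>n\<close>. The underlying probability space is the canonical one: a sample
  point \<open>(u, z, k)\<close> consists of the private randomness \<open>u i\<close> of every user \<open>i\<close>, the components
  \<open>z s i\<close> of the \<open>s\<close>-th source symbol (\<open>s < n\<close>), and the key \<open>k\<close>; the scheme fixes their joint law.
  The private randomness is real-valued with arbitrary Borel laws, which covers all discrete laws.
  Key values and public messages are coded as natural numbers.

  Rounds are numbered from \<open>0\<close>. The message sent in round \<open>t\<close> is a function of the list of the \<open>t\<close>
  previous messages and of the private knowledge of \<open>speaker t\<close>. The discussion is the infinite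
  sequence of all messages; discussions with finitely many rounds are those in which all later
  messages are constant.
\<close>

record 'z scheme =
  rand_law :: "nat \<Rightarrow> real measure"
  joint_law :: "((nat \<Rightarrow> real) \<times> (nat \<Rightarrow> nat \<Rightarrow> 'z) \<times> nat) measure"
  speaker :: "nat \<Rightarrow> nat"
  message :: "nat \<Rightarrow> nat list \<Rightarrow> real \<times> (nat \<Rightarrow> 'z) \<Rightarrow> nat"
  decoder :: "nat \<Rightarrow> (nat \<Rightarrow> nat) \<Rightarrow> real \<times> (nat \<Rightarrow> 'z) \<Rightarrow> nat"
  disc_alphabet :: "(nat \<Rightarrow> nat) set"
  key_alphabet :: "nat set"

definition priv ::
  "nat \<Rightarrow> nat \<Rightarrow> (nat \<Rightarrow> real) \<times> (nat \<Rightarrow> nat \<Rightarrow> 'z) \<times> nat \<Rightarrow> real \<times> (nat \<Rightarrow> 'z)" where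
  "priv n i = (\<lambda>(u, z, k). (u i, \<lambda>s\<in>{..<n}. z s i))"

definition key :: "(nat \<Rightarrow> real) \<times> (nat \<Rightarrow> nat \<Rightarrow> 'z) \<times> nat \<Rightarrow> nat" where
  "key = (\<lambda>(u, z, k). k)"

primrec history ::
  "nat \<Rightarrow> 'z scheme \<Rightarrow> nat \<Rightarrow> (nat \<Rightarrow> real) \<times> (nat \<Rightarrow> nat \<Rightarrow> 'z) \<times> nat \<Rightarrow> nat list" where
  "history n S 0 \<omega> = []"
| "history n S (Suc t) \<omega> =
     history n S t \<omega> @ [message S t (history n S t \<omega>) (priv n (speaker S t) \<omega>)]"

definition discussion ::
  "nat \<Rightarrow> 'z scheme \<Rightarrow> (nat \<Rightarrow> real) \<times> (nat \<Rightarrow> nat \<Rightarrow> 'z) \<times> nat \<Rightarrow> nat \<Rightarrow> nat" where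
  "discussion n S \<omega> t = message S t (history n S t \<omega>) (priv n (speaker S t) \<omega>)"

text \<open>
  The equation for the marginal of \<open>joint_law\<close> says that the private random variables are mutually
  independent, that the source symbols are i.i.d. with law \<open>PZ\<close>, and that both are independent of each
  other. The key may depend on them in an arbitrary, possibly randomized, way.
\<close>

definition is_scheme ::
  "nat set \<Rightarrow> (nat \<Rightarrow> 'z set) \<Rightarrow> (nat \<Rightarrow> 'z) measure \<Rightarrow> nat \<Rightarrow> 'z scheme \<Rightarrow> bool" where
  "is_scheme V A PZ n S \<longleftrightarrow>
     (let U = (\<Pi>\<^sub>M i\<in>V. (borel :: real measure));
          Zn = (\<Pi>\<^sub>M s\<in>{..<n}. \<Pi>\<^sub>M i\<in>V. count_space (A i));
          P = (\<lambda>i. (borel :: real measure) \<Otimes>\<^sub>M (\<Pi>\<^sub>M s\<in>{..<n}. count_space (A i)))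
      in (\<forall>i\<in>V. prob_space (rand_law S i) \<and> sets (rand_law S i) = sets borel) \<and>
         finite (key_alphabet S) \<and>
         prob_space (joint_law S) \<and>
         sets (joint_law S) = sets (U \<Otimes>\<^sub>M Zn \<Otimes>\<^sub>M count_space (key_alphabet S)) \<and>
         distr (joint_law S) (U \<Otimes>\<^sub>M Zn) (\<lambda>(u, z, k). (u, z)) =
           (\<Pi>\<^sub>M i\<in>V. rand_law S i) \<Otimes>\<^sub>M (\<Pi>\<^sub>M s\<in>{..<n}. PZ) \<and>
         (\<forall>t. speaker S t \<in> V) \<and>
         (\<forall>t h. message S t h \<in> measurable (P (speaker S t)) (count_space UNIV)) \<and>
         finite (disc_alphabet S) \<and>
         (\<forall>\<omega>\<in>space (joint_law S). discussion n S \<omega> \<in> disc_alphabet S) \<and>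
         (\<forall>i\<in>V. \<forall>f\<in>disc_alphabet S. decoder S i f \<in> measurable (P i) (count_space UNIV)))"

definition error_prob :: "nat set \<Rightarrow> nat \<Rightarrow> 'z scheme \<Rightarrow> real" where
  "error_prob V n S = measure (joint_law S)
     {\<omega> \<in> space (joint_law S). \<exists>i\<in>V. key \<omega> \<noteq> decoder S i (discussion n S \<omega>) (priv n i \<omega>)}"

definition recoverable :: "nat set \<Rightarrow> (nat \<Rightarrow> 'z scheme) \<Rightarrow> bool" where
  "recoverable V S \<longleftrightarrow> (\<lambda>n. error_prob V n (S n)) \<longlonglongrightarrow> 0"

definition secret :: "real \<Rightarrow> (nat \<Rightarrow> 'z scheme) \<Rightarrow> bool" where
  "secret b S \<longleftrightarrow>
     limsup (\<lambda>n. ereal (1 / real n *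
       (log b (real (card (key_alphabet (S n)))) -
        cond_ent b (joint_law (S n)) key (discussion n (S n))))) = 0"

definition key_rate :: "real \<Rightarrow> (nat \<Rightarrow> 'z scheme) \<Rightarrow> ereal" where
  "key_rate b S = liminf (\<lambda>n. ereal (1 / real n * log b (real (card (key_alphabet (S n))))))"

definition discussion_rate :: "real \<Rightarrow> (nat \<Rightarrow> 'z scheme) \<Rightarrow> ereal" where
  "discussion_rate b S = limsup (\<lambda>n. ereal (1 / real n * log b (real (card (disc_alphabet (S n))))))"

definition secrecy_capacity ::
  "real \<Rightarrow> nat set \<Rightarrow> (nat \<Rightarrow> 'z set) \<Rightarrow> (nat \<Rightarrow> 'z) measure \<Rightarrow> real \<Rightarrow> ereal" where
  "secrecy_capacity b V A PZ R =
     Sup {key_rate b S | S.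
       (\<forall>n>0. is_scheme V A PZ n (S n)) \<and> recoverable V S \<and> secret b S \<and>
       discussion_rate b S \<le> ereal R}"


section \<open>The partition parameter\<close>

text \<open>
  If every edge contains all users, the maximum ranges over the empty set. Then the value is \<open>0\<close>, as
  if there were an additional edge \<open>{i}\<close> with a constant edge variable.
\<close>

definition alpha :: "nat set \<Rightarrow> 'e set \<Rightarrow> ('e \<Rightarrow> nat set) \<Rightarrow> nat set set \<Rightarrow> real" where
  "alpha V E \<xi> P =
     (if {e\<in>E. \<xi> e \<noteq> V} = {} then 0
      else (real (MAX e\<in>{e\<in>E. \<xi> e \<noteq> V}. card {C\<in>P. C \<inter> \<xi> e \<noteq> {}}) - 1) / (real (card P) - 1))"

end

theory Submission
  imports Defs
begin

text \<open>
  Fix a block length \<open>n\<close>. Let \<open>G\<close> be the \<open>n\<close>-fold common part, \<open>F\<close> the discussion, \<open>K\<close> the key, \<open>S\<^sub>C\<close> the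
  private knowledge of the users in the block \<open>C\<close>, and \<open>p\<close> the largest number of blocks that an edge
  other than \<open>V\<close> meets. Given \<open>G\<close>, the families \<open>S\<^sub>C\<close> are made of independent variables each of which
  occurs in at most \<open>p\<close> blocks, so \<open>\<Sum>\<^sub>C I(S\<^sub>C; F, K | G) \<le> p H(F, K | G)\<close>. On the other hand every message
  is determined by the earlier ones and a single block, so \<open>\<Sum>\<^sub>C I(S\<^sub>C; F | G) \<ge> H(F | G)\<close>, and by
  Fano's inequality \<open>I(S\<^sub>C; K | F, G)\<close> is almost \<open>H(K | F, G)\<close>. Together
  \<open>(|P| - p) H(K | F, G) \<le> (p - 1) H(F | G) + |P| \<epsilon>\<close>; now \<open>H(K | F, G) \<ge> H(K | F) - H(G)\<close> and
  \<open>H(F | G) \<le> log |F|\<close>, and dividing by \<open>n (|P| - 1)\<close> gives the claim in the limit.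
\<close>

section \<open>Entropy of simple functions\<close>

text \<open>Entropies are available only for finitely-valued variables, while the private randomness
  is real and the discussion is an infinite sequence. So the private variable of a user is replaced
  by a finite table of all that it could make this user say or decode, and the discussion by a
  prefix long enough to separate the finite discussion alphabet. The tables are independent of each
  other and of the edge variables; a table belongs to a single block, so p \<ge> 1 puts it under the
  same covering bound as an edge. Edges equal to V meet all blocks and would force p = |P|;
  conditioning on G removes them at the price of H(G). The covering bound rests on the
  supermodularity of -H(T | W_L) in the index set L, which holds because H(W_L) is additive over L;
  independence enters as this additivity. Source and scheme live on different probability spaces
  that share only the law of the source, so the edge structure has to be carried over to that law.
  Key rates may be unbounded; hence the product of error probability and key rate is absorbed on the
  left before any limit is taken.\<close>

context information_space
begin

text \<open>The probability of the value that \<open>X\<close> takes, itself a random variable.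
  Entropy is minus the expectation of its logarithm, so entropy relations follow by integrating
  almost sure pointwise ones.\<close>

definition pointmass :: "('a \<Rightarrow> 'b) \<Rightarrow> 'a \<Rightarrow> real" where
  "pointmass X \<omega> = prob (X -` {X \<omega>} \<inter> space M)"

lemma expectation_simple_function:
  fixes g :: "'b \<Rightarrow> real"
  assumes X: "simple_function M X"
  shows "expectation (\<lambda>\<omega>. g (X \<omega>)) = (\<Sum>x\<in>X ` space M. prob (X -` {x} \<inter> space M) * g x)"
proof -
  have sd: "simple_distributed M X (\<lambda>x. prob (X -` {x} \<inter> space M))"
    using X by (rule simple_distributedI) auto
  have "expectation (\<lambda>\<omega>. g (X \<omega>)) = (\<integral>x. prob (X -` {x} \<inter> space M) * g x \<partial>count_space (X ` space M))"
    by (rule distributed_integral[OF simple_distributed[OF sd], symmetric]) auto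
  also have "\<dots> = (\<Sum>x\<in>X ` space M. prob (X -` {x} \<inter> space M) * g x)"
    using simple_functionD(1)[OF X] by (rule lebesgue_integral_count_space_finite)
  finally show ?thesis .
qed

lemma integrable_simple_function_compose:
  fixes g :: "'b \<Rightarrow> real"
  assumes X: "simple_function M X"
  shows "integrable M (\<lambda>\<omega>. g (X \<omega>))"
proof -
  have "simple_function M (\<lambda>\<omega>. g (X \<omega>))"
    using simple_function_compose[OF X, of g] by (simp add: comp_def)
  then have "Bochner_Integration.simple_bochner_integrable M (\<lambda>\<omega>. g (X \<omega>))"
    by (auto intro!: simple_bochner_integrable.intros emeasure_finite)
  then show ?thesis
    by (auto intro: integrableI_simple_bochner_integrable)
qed

lemma integrable_log_pointmass:
  "simple_function M X \<Longrightarrow> integrable M (\<lambda>\<omega>. log b (pointmass X \<omega>))"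
  unfolding pointmass_def by (rule integrable_simple_function_compose)

lemma entropy_eq_expectation:
  assumes X: "simple_function M X"
  shows "\<H>(X) = - expectation (\<lambda>\<omega>. log b (pointmass X \<omega>))"
  unfolding pointmass_def
  using entropy_simple_distributed[OF simple_distributedI[OF X measure_nonneg refl]]
    expectation_simple_function[OF X, of "\<lambda>x. log b (prob (X -` {x} \<inter> space M))"] by simp

text \<open>Each value of probability zero is taken on a null event only, and there are finitely
  many values. Logarithms of products and quotients of point masses may then be split almost
  surely.\<close>

lemma AE_pointmass_pos:
  assumes X: "simple_function M X"
  shows "AE \<omega> in M. 0 < pointmass X \<omega>"
proof -
  have fin: "finite (X ` space M)" by (rule simple_functionD[OF X])
  have "AE \<omega> in M. \<forall>x\<in>X ` space M. prob (X -` {x} \<inter> space M) = 0 \<longrightarrow> \<omega> \<notin> X -` {x} \<inter> space M"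
  proof (rule AE_finite_allI[OF fin])
    fix x
    have ev: "X -` {x} \<inter> space M \<in> events" using simple_functionD(2)[OF X] .
    show "AE \<omega> in M. prob (X -` {x} \<inter> space M) = 0 \<longrightarrow> \<omega> \<notin> X -` {x} \<inter> space M"
      using prob_eq_0[OF ev] by (cases "prob (X -` {x} \<inter> space M) = 0") auto
  qed
  with AE_space show ?thesis
    by eventually_elim (auto simp: pointmass_def less_le)
qed

lemma entropy_cong_AE:
  assumes X: "simple_function M X" and Y: "simple_function M Y" and eq: "AE \<omega> in M. X \<omega> = Y \<omega>"
  shows "\<H>(X) = \<H>(Y)"
proof -
  have "prob (X -` {x} \<inter> space M) = prob (Y -` {x} \<inter> space M)" for x
    using eq simple_functionD(2)[OF X] simple_functionD(2)[OF Y] by (intro finite_measure_eq_AE) auto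
  then have "expectation (\<lambda>\<omega>. log b (pointmass X \<omega>)) = expectation (\<lambda>\<omega>. log b (pointmass Y \<omega>))"
    using eq by (intro integral_cong_AE borel_measurable_integrable integrable_log_pointmass X Y)
      (auto simp: pointmass_def)
  then show ?thesis by (simp add: entropy_eq_expectation X Y)
qed

text \<open>Users know their edge variables, and edge variables determine the observations, only up
  to null sets; hence the almost sure form.\<close>

lemma entropy_mono_AE:
  assumes X: "simple_function M X" and Y: "simple_function M Y" and eq: "AE \<omega> in M. X \<omega> = f (Y \<omega>)"
  shows "\<H>(X) \<le> \<H>(Y)"
proof -
  have "\<H>(X) = \<H>(f \<circ> Y)"
    using eq by (intro entropy_cong_AE X simple_function_compose[OF Y]) (simp add: comp_def)
  also have "\<dots> \<le> \<H>(Y)" by (rule entropy_data_processing[OF Y])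
  finally show ?thesis .
qed

lemma entropy_mono:
  assumes X: "simple_function M X" and Y: "simple_function M Y"
    and eq: "\<And>\<omega>. \<omega> \<in> space M \<Longrightarrow> X \<omega> = f (Y \<omega>)"
  shows "\<H>(X) \<le> \<H>(Y)"
  by (rule entropy_mono_AE[OF X Y, of f]) (rule AE_I2[OF eq])

text \<open>Nonnegativity of I(X; Y | Z), expanded into joint entropies so that later estimates are
  linear in these.\<close>

lemma entropy_submodular:
  assumes X: "simple_function M X" and Y: "simple_function M Y" and Z: "simple_function M Z"
  shows "\<H>(\<lambda>\<omega>. (X \<omega>, Y \<omega>, Z \<omega>)) + \<H>(Z) \<le> \<H>(\<lambda>\<omega>. (X \<omega>, Z \<omega>)) + \<H>(\<lambda>\<omega>. (Y \<omega>, Z \<omega>))"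
proof -
  let ?XZ = "\<lambda>\<omega>. (X \<omega>, Z \<omega>)" and ?YZ = "\<lambda>\<omega>. (Y \<omega>, Z \<omega>)" and ?XYZ = "\<lambda>\<omega>. (X \<omega>, Y \<omega>, Z \<omega>)"
  note sf = X Y Z simple_function_Pair[OF X Z] simple_function_Pair[OF Y Z]
    simple_function_Pair[OF X simple_function_Pair[OF Y Z]]
  note sd = simple_distributedI[OF _ measure_nonneg refl]
  have "0 \<le> \<I>(X ; Y | Z)" by (rule conditional_mutual_information_nonneg[OF X Y Z])
  also have "\<I>(X ; Y | Z) = (\<Sum>w\<in>?XYZ ` space M. prob (?XYZ -` {w} \<inter> space M) *
      (case w of (x, y, z) \<Rightarrow> log b (prob (?XYZ -` {w} \<inter> space M) /
        (prob (?XZ -` {(x, z)} \<inter> space M) * (prob (?YZ -` {(y, z)} \<inter> space M) / prob (Z -` {z} \<inter> space M))))))"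
    by (subst conditional_mutual_information_eq[OF sd[OF sf(3)] sd[OF sf(5)] sd[OF sf(4)] sd[OF sf(6)]])
       (auto intro!: sum.cong)
  also have "\<dots> = expectation (\<lambda>\<omega>. log b (pointmass ?XYZ \<omega> /
        (pointmass ?XZ \<omega> * (pointmass ?YZ \<omega> / pointmass Z \<omega>))))"
    unfolding expectation_simple_function[OF sf(6), symmetric] pointmass_def by simp
  also have "\<dots> = expectation (\<lambda>\<omega>. log b (pointmass ?XYZ \<omega>) - log b (pointmass ?XZ \<omega>)
      - log b (pointmass ?YZ \<omega>) + log b (pointmass Z \<omega>))"
  proof (intro integral_cong_AE)
    have sf': "simple_function M (\<lambda>\<omega>. (X \<omega>, Y \<omega>, Z \<omega>))" by fact
    show "(\<lambda>\<omega>. log b (pointmass ?XYZ \<omega> / (pointmass ?XZ \<omega> * (pointmass ?YZ \<omega> / pointmass Z \<omega>)))) \<in> borel_measurable M"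
      using borel_measurable_integrable[OF integrable_simple_function_compose[OF sf',
        of "\<lambda>w. (case w of (x, y, z) \<Rightarrow> log b (prob (?XYZ -` {w} \<inter> space M) /
        (prob (?XZ -` {(x, z)} \<inter> space M) * (prob (?YZ -` {(y, z)} \<inter> space M) / prob (Z -` {z} \<inter> space M)))))"]]
      by (simp add: pointmass_def)
    show "(\<lambda>\<omega>. log b (pointmass ?XYZ \<omega>) - log b (pointmass ?XZ \<omega>)
      - log b (pointmass ?YZ \<omega>) + log b (pointmass Z \<omega>)) \<in> borel_measurable M"
      by (intro borel_measurable_integrable Bochner_Integration.integrable_add
          Bochner_Integration.integrable_diff integrable_log_pointmass sf)
    show "AE \<omega> in M. log b (pointmass ?XYZ \<omega> / (pointmass ?XZ \<omega> * (pointmass ?YZ \<omega> / pointmass Z \<omega>)))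
      = log b (pointmass ?XYZ \<omega>) - log b (pointmass ?XZ \<omega>) - log b (pointmass ?YZ \<omega>) + log b (pointmass Z \<omega>)"
      using AE_pointmass_pos[OF sf(3)] AE_pointmass_pos[OF sf(4)] AE_pointmass_pos[OF sf(5)] AE_pointmass_pos[OF sf(6)]
      by eventually_elim (simp add: log_mult log_divide)
  qed
  also have "\<dots> = - \<H>(?XYZ) + \<H>(?XZ) + \<H>(?YZ) - \<H>(Z)"
    by (simp add: entropy_eq_expectation sf integrable_log_pointmass)
  finally show ?thesis by simp
qed

lemma entropy_nonneg:
  assumes "simple_function M X" shows "0 \<le> \<H>(X)"
proof -
  have "AE \<omega> in M. log b (pointmass X \<omega>) \<le> 0"
    using AE_pointmass_pos[OF assms] by eventually_elim (simp add: pointmass_def b_gt_1)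
  then have "expectation (\<lambda>\<omega>. log b (pointmass X \<omega>)) \<le> expectation (\<lambda>_. 0)"
    by (intro integral_mono_AE integrable_log_pointmass assms) auto
  then show ?thesis by (simp add: entropy_eq_expectation assms)
qed

lemma entropy_const: "\<H>(\<lambda>_. c) = 0"
proof -
  have "pointmass (\<lambda>_. c) \<omega> = 1" for \<omega> by (simp add: pointmass_def prob_space)
  then show ?thesis by (simp add: entropy_eq_expectation)
qed

text \<open>Submodularity with a constant as third variable, which can be paired in and dropped at
  no cost.\<close>

lemma entropy_subadditive:
  assumes X: "simple_function M X" and Y: "simple_function M Y"
  shows "\<H>(\<lambda>\<omega>. (X \<omega>, Y \<omega>)) \<le> \<H>(X) + \<H>(Y)"
proof -
  note sf = X Y simple_function_const[of M "0::nat"]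
  have "\<H>(\<lambda>\<omega>. (X \<omega>, Y \<omega>)) \<le> \<H>(\<lambda>\<omega>. (X \<omega>, Y \<omega>, 0::nat))"
    by (rule entropy_mono[where f="\<lambda>(x,y,_). (x,y)"]) (auto intro!: simple_function_Pair sf)
  moreover have "\<H>(\<lambda>\<omega>. (X \<omega>, 0::nat)) \<le> \<H>(X)" "\<H>(\<lambda>\<omega>. (Y \<omega>, 0::nat)) \<le> \<H>(Y)"
    by (rule entropy_mono[where f="\<lambda>x. (x, 0::nat)"]; auto intro!: simple_function_Pair sf)+
  ultimately show ?thesis
    using entropy_submodular[OF sf] by (simp add: entropy_const)
qed

lemma gibbs_inequality:
  fixes q :: "'b \<Rightarrow> real"
  assumes X: "simple_function M X" and q0: "\<And>x. x \<in> X ` space M \<Longrightarrow> 0 \<le> q x"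
    and q1: "(\<Sum>x\<in>X ` space M. q x) \<le> 1"
    and pos: "AE \<omega> in M. 0 < q (X \<omega>)"
  shows "\<H>(X) \<le> - expectation (\<lambda>\<omega>. log b (q (X \<omega>)))"
proof -
  note int = integrable_simple_function_compose[OF X]
  let ?p = "\<lambda>x. prob (X -` {x} \<inter> space M)"
  have "expectation (\<lambda>\<omega>. log b (q (X \<omega>)) - log b (?p (X \<omega>)))
      \<le> expectation (\<lambda>\<omega>. (q (X \<omega>) / ?p (X \<omega>) - 1) / ln b)"
  proof (intro integral_mono_AE)
    show "AE \<omega> in M. log b (q (X \<omega>)) - log b (?p (X \<omega>)) \<le> (q (X \<omega>) / ?p (X \<omega>) - 1) / ln b"
      using pos AE_pointmass_pos[OF X]
    proof eventually_elim
      case (elim \<omega>)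
      have "ln (q (X \<omega>) / ?p (X \<omega>)) \<le> q (X \<omega>) / ?p (X \<omega>) - 1"
        using elim by (intro ln_le_minus_one) (simp add: pointmass_def)
      then have "log b (q (X \<omega>) / ?p (X \<omega>)) \<le> (q (X \<omega>) / ?p (X \<omega>) - 1) / ln b"
        unfolding log_def using b_gt_1 by (intro divide_right_mono) auto
      then show ?case using elim by (simp add: pointmass_def log_divide)
    qed
  qed (rule int)+
  also have "\<dots> = (\<Sum>x\<in>X ` space M. ?p x * ((q x / ?p x - 1) / ln b))"
    by (rule expectation_simple_function[OF X])
  \<comment> \<open>Equality fails only at values of probability zero, where the left term vanishes
    and the right one is q x / ln b \<ge> 0.\<close>
  also have "\<dots> \<le> (\<Sum>x\<in>X ` space M. (q x - ?p x) / ln b)"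
  proof (intro sum_mono)
    fix x assume "x \<in> X ` space M"
    then show "?p x * ((q x / ?p x - 1) / ln b) \<le> (q x - ?p x) / ln b"
      using b_gt_1 q0[of x] by (cases "?p x = 0") (auto simp: field_simps)
  qed
  also have "\<dots> = ((\<Sum>x\<in>X ` space M. q x) - (\<Sum>x\<in>X ` space M. ?p x)) / ln b"
    by (simp add: sum_subtractf flip: sum_divide_distrib)
  also have "(\<Sum>x\<in>X ` space M. ?p x) = 1"
    using expectation_simple_function[OF X, of "\<lambda>_. 1"] by (simp add: prob_space)
  also have "((\<Sum>x\<in>X ` space M. q x) - 1) / ln b \<le> 0"
    using q1 b_gt_1 by (auto simp: divide_le_0_iff)
  finally show ?thesis
    using int[of "\<lambda>x. log b (q x)"] int[of "\<lambda>x. log b (?p x)"]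
    by (simp add: entropy_eq_expectation[OF X] pointmass_def)
qed

lemma entropy_le_log_card:
  assumes X: "simple_function M X" and S: "finite S" "X ` space M \<subseteq> S"
  shows "\<H>(X) \<le> log b (real (card S))"
proof -
  have c: "0 < card (X ` space M)" "card (X ` space M) \<le> card S"
    using simple_functionD(1)[OF X] S not_empty by (auto simp: card_gt_0_iff card_mono)
  have "\<H>(X) \<le> log b (real (card (X ` space M)))"
    by (rule entropy_le_card[OF simple_distributedI[OF X measure_nonneg refl]])
  also have "\<dots> \<le> log b (real (card S))"
    using c b_gt_1 by simp
  finally show ?thesis .
qed

section \<open>Entropy of families of variables\<close>

lemma simple_function_restrict:
  assumes "finite J" "\<And>j. j \<in> J \<Longrightarrow> simple_function M (Y j)"
  shows "simple_function M (\<lambda>\<omega>. \<lambda>j\<in>J. Y j \<omega>)"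
  unfolding simple_function_def
proof (intro conjI ballI)
  have "(\<lambda>\<omega>. \<lambda>j\<in>J. Y j \<omega>) ` space M \<subseteq> (\<Pi>\<^sub>E j\<in>J. Y j ` space M)" by auto
  then show "finite ((\<lambda>\<omega>. \<lambda>j\<in>J. Y j \<omega>) ` space M)"
    by (rule finite_subset) (intro finite_PiE assms simple_functionD; simp)
  fix y
  have "(\<lambda>\<omega>. \<lambda>j\<in>J. Y j \<omega>) -` {y} \<inter> space M = {\<omega>\<in>space M. y \<in> extensional J \<and> (\<forall>j\<in>J. Y j \<omega> = y j)}"
    by (auto simp: extensional_def fun_eq_iff restrict_def)
  moreover have "{\<omega>\<in>space M. \<forall>j\<in>J. Y j \<omega> = y j} \<in> events"
  proof (intro sets.sets_Collect_finite_All assms(1))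
    fix j assume "j \<in> J"
    have "{\<omega>\<in>space M. Y j \<omega> = y j} = Y j -` {y j} \<inter> space M" by auto
    then show "{\<omega>\<in>space M. Y j \<omega> = y j} \<in> events"
      using simple_functionD(2)[OF assms(2)[OF \<open>j \<in> J\<close>]] by simp
  qed
  ultimately show "(\<lambda>\<omega>. \<lambda>j\<in>J. Y j \<omega>) -` {y} \<inter> space M \<in> events"
    by (cases "y \<in> extensional J") auto
qed

lemma entropy_restrict_le_sum:
  assumes "finite J" "\<And>j. j \<in> J \<Longrightarrow> simple_function M (Y j)"
  shows "\<H>(\<lambda>\<omega>. \<lambda>j\<in>J. Y j \<omega>) \<le> (\<Sum>j\<in>J. \<H>(Y j))"
  using assms
proof (induction J rule: finite_induct)
  case empty
  show ?case by (simp add: restrict_def entropy_const)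
next
  case (insert i J)
  have sf: "simple_function M (Y i)" "simple_function M (\<lambda>\<omega>. \<lambda>j\<in>J. Y j \<omega>)"
    "simple_function M (\<lambda>\<omega>. \<lambda>j\<in>insert i J. Y j \<omega>)"
    using insert by (auto intro!: simple_function_restrict)
  have "\<H>(\<lambda>\<omega>. \<lambda>j\<in>insert i J. Y j \<omega>) \<le> \<H>(\<lambda>\<omega>. (Y i \<omega>, \<lambda>j\<in>J. Y j \<omega>))"
    by (rule entropy_mono[where f="\<lambda>(y, g). \<lambda>j\<in>insert i J. if j = i then y else g j"])
       (use sf insert.hyps in \<open>auto intro!: simple_function_Pair simp: fun_eq_iff restrict_def\<close>)
  also have "\<dots> \<le> \<H>(Y i) + \<H>(\<lambda>\<omega>. \<lambda>j\<in>J. Y j \<omega>)" by (rule entropy_subadditive[OF sf(1,2)])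
  finally show ?case using insert.IH[OF insert.prems] insert.hyps by (simp del: restrict_apply)
qed

text \<open>
  The weights \<open>q j\<close> turn out to be the marginal laws, but Gibbs' inequality makes it unnecessary to
  know that.
\<close>

lemma entropy_restrict_ge_sum:
  assumes J: "finite J" and Y: "\<And>j. j \<in> J \<Longrightarrow> simple_function M (Y j)"
    and q0: "\<And>j x. j \<in> J \<Longrightarrow> 0 \<le> q j x"
    and q1: "\<And>j. j \<in> J \<Longrightarrow> (\<Sum>x\<in>Y j ` space M. q j x) \<le> 1"
    and joint: "\<And>y. y \<in> (\<Pi>\<^sub>E j\<in>J. Y j ` space M) \<Longrightarrow>
       prob {\<omega>\<in>space M. \<forall>j\<in>J. Y j \<omega> = y j} = (\<Prod>j\<in>J. q j (y j))"
  shows "(\<Sum>j\<in>J. \<H>(Y j)) \<le> \<H>(\<lambda>\<omega>. \<lambda>j\<in>J. Y j \<omega>)"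
proof -
  let ?Y = "\<lambda>\<omega>. \<lambda>j\<in>J. Y j \<omega>"
  have sf: "simple_function M ?Y" using J Y by (rule simple_function_restrict)
  have pm: "pointmass ?Y \<omega> = (\<Prod>j\<in>J. q j (Y j \<omega>))" if "\<omega> \<in> space M" for \<omega>
  proof -
    have "?Y -` {?Y \<omega>} \<inter> space M = {\<omega>'\<in>space M. \<forall>j\<in>J. Y j \<omega>' = ?Y \<omega> j}"
      by (auto simp: restrict_def fun_eq_iff split: if_splits; metis)
    then show ?thesis
      using joint[of "?Y \<omega>"] that by (simp add: pointmass_def)
  qed
  have pos: "AE \<omega> in M. \<forall>j\<in>J. 0 < q j (Y j \<omega>)"
    using AE_space AE_pointmass_pos[OF sf]
  proof eventually_elim
    case (elim \<omega>)
    then have "(\<Prod>j\<in>J. q j (Y j \<omega>)) \<noteq> 0" using pm by auto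
    then show ?case using J q0 by (auto simp: less_le)
  qed
  have "(\<Sum>j\<in>J. \<H>(Y j)) \<le> (\<Sum>j\<in>J. - expectation (\<lambda>\<omega>. log b (q j (Y j \<omega>))))"
    using pos by (intro sum_mono gibbs_inequality Y q1) (auto intro!: q0)
  also have "\<dots> = - expectation (\<lambda>\<omega>. \<Sum>j\<in>J. log b (q j (Y j \<omega>)))"
    unfolding sum_negf
    by (subst Bochner_Integration.integral_sum) (rule integrable_simple_function_compose[OF Y] refl | assumption)+
  also have "expectation (\<lambda>\<omega>. \<Sum>j\<in>J. log b (q j (Y j \<omega>))) = expectation (\<lambda>\<omega>. log b (pointmass ?Y \<omega>))"
  proof (intro integral_cong_AE borel_measurable_integrable integrable_log_pointmass sf
      Bochner_Integration.integrable_sum integrable_simple_function_compose[OF Y])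
    show "AE \<omega> in M. (\<Sum>j\<in>J. log b (q j (Y j \<omega>))) = log b (pointmass ?Y \<omega>)"
      using AE_space pos
    proof eventually_elim
      case (elim \<omega>)
      have "ln (\<Prod>j\<in>J. q j (Y j \<omega>)) = (\<Sum>j\<in>J. ln (q j (Y j \<omega>)))"
        using J elim by (intro ln_prod) auto
      then show ?case using pm elim by (simp add: log_def sum_divide_distrib)
    qed
  qed
  finally show ?thesis by (simp add: entropy_eq_expectation[OF sf])
qed

text \<open>The variable \<open>E\<close> stays silent when the guess is right and reveals
  \<open>X\<close> otherwise, so \<open>E\<close> and \<open>W\<close> determine \<open>X\<close>.
  The constant log 2 stands in for the binary entropy of the error; it vanishes after division by
  the block length.\<close>

lemma fano_inequality:
  assumes X: "simple_function M X" and W: "simple_function M W"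
    and S: "finite S" "X ` space M \<subseteq> S"
  shows "\<H>(\<lambda>\<omega>. (X \<omega>, W \<omega>)) \<le> \<H>(W) + log b 2 +
    prob {\<omega>\<in>space M. X \<omega> \<noteq> g (W \<omega>)} * log b (real (card S))"
proof -
  define E where "E \<omega> = (if X \<omega> = g (W \<omega>) then None else Some (X \<omega>))" for \<omega>
  have sf: "simple_function M E"
    using simple_function_compose[OF simple_function_Pair[OF X W], of "\<lambda>(x, w). if x = g w then None else Some x"]
    by (simp add: comp_def E_def[abs_def])
  have c: "0 < card S" using S not_empty by (auto simp: card_gt_0_iff)
  have ev: "{\<omega>\<in>space M. X \<omega> \<noteq> g (W \<omega>)} \<in> events"
  proof -
    have "{\<omega>\<in>space M. X \<omega> \<noteq> g (W \<omega>)} = space M - (E -` {None} \<inter> space M)"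
      by (auto simp: E_def)
    then show ?thesis using simple_functionD(2)[OF sf] by (auto intro: sets.Diff)
  qed
  \<comment> \<open>Gibbs with half of the mass on "no error" and the other half spread evenly over \<open>S\<close>\<close>
  define q :: "'b option \<Rightarrow> real" where "q x = (case x of None \<Rightarrow> 1/2 | Some _ \<Rightarrow> 1 / (2 * real (card S)))" for x
  have "\<H>(\<lambda>\<omega>. (X \<omega>, W \<omega>)) \<le> \<H>(\<lambda>\<omega>. (E \<omega>, W \<omega>))"
    by (rule entropy_mono[where f="\<lambda>(e, w). (case e of None \<Rightarrow> g w | Some x \<Rightarrow> x, w)"])
       (rule simple_function_Pair X W sf | simp add: E_def)+
  also have "\<dots> \<le> \<H>(E) + \<H>(W)" by (rule entropy_subadditive[OF sf W])
  also have "\<H>(E) \<le> - expectation (\<lambda>\<omega>. log b (q (E \<omega>)))"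
  proof (rule gibbs_inequality[OF sf])
    have "(\<Sum>x\<in>E ` space M. q x) \<le> (\<Sum>x\<in>insert None (Some ` S). q x)"
      using S by (intro sum_mono2) (auto simp: E_def q_def split: option.splits)
    also have "\<dots> = 1"
      using S c by (auto simp: q_def sum.reindex)
    finally show "(\<Sum>x\<in>E ` space M. q x) \<le> 1" .
  qed (use c in \<open>auto simp: q_def split: option.splits\<close>)
  also have "expectation (\<lambda>\<omega>. log b (q (E \<omega>))) =
    expectation (\<lambda>\<omega>. - log b 2 - indicator {\<omega>\<in>space M. X \<omega> \<noteq> g (W \<omega>)} \<omega> * log b (real (card S)))"
    using c b_gt_1
    by (intro Bochner_Integration.integral_cong)
       (auto simp: q_def E_def log_divide log_mult indicator_def)
  also have "\<dots> = - log b 2 - prob {\<omega>\<in>space M. X \<omega> \<noteq> g (W \<omega>)} * log b (real (card S))"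
    using ev by (subst Bochner_Integration.integral_diff)
      (auto simp: prob_space integrable_real_indicator emeasure_eq_measure)
  finally show ?thesis by simp
qed

section \<open>Conditional entropy and functional dependence\<close>

lemma conditional_entropy_eq_diff:
  assumes X: "simple_function M X" and Y: "simple_function M Y"
  shows "\<H>(X | Y) = \<H>(\<lambda>\<omega>. (X \<omega>, Y \<omega>)) - \<H>(Y)"
proof -
  have "\<H>(\<lambda>\<omega>. (X \<omega>, Y \<omega>)) = \<H>(\<lambda>\<omega>. (Y \<omega>, X \<omega>))"
    by (intro antisym entropy_mono[where f=prod.swap] simple_function_Pair X Y) auto
  then show ?thesis using entropy_chain_rule[OF Y X] by simp
qed

text \<open>H(X | Y) is the expectation of log p(Y) - log p(X, Y), which is nonnegative almost
  surely; if it is zero, p(X, Y) = p(Y) almost surely. One value of \<open>X\<close> then carries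
  the whole mass of the value of \<open>Y\<close>, and a second one of positive mass would exceed
  it.\<close>

lemma conditional_entropy_0_imp_function:
  assumes X: "simple_function M X" and Y: "simple_function M Y" and 0: "\<H>(X | Y) = 0"
  shows "\<exists>f. AE \<omega> in M. X \<omega> = f (Y \<omega>)"
proof -
  let ?XY = "\<lambda>\<omega>. (X \<omega>, Y \<omega>)"
  note XY = simple_function_Pair[OF X Y]
  have le: "pointmass ?XY \<omega> \<le> pointmass Y \<omega>" for \<omega>
    unfolding pointmass_def using simple_functionD(2)[OF Y] by (intro finite_measure_mono) auto
  have nn: "AE \<omega> in M. 0 \<le> log b (pointmass Y \<omega>) - log b (pointmass ?XY \<omega>)"
    using AE_pointmass_pos[OF XY] AE_pointmass_pos[OF Y]
    by eventually_elim (use le b_gt_1 in auto)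
  have int: "integrable M (\<lambda>\<omega>. log b (pointmass Y \<omega>) - log b (pointmass ?XY \<omega>))"
    by (intro Bochner_Integration.integrable_diff integrable_log_pointmass XY Y)
  have "expectation (\<lambda>\<omega>. log b (pointmass Y \<omega>) - log b (pointmass ?XY \<omega>)) = 0"
    using 0 by (simp add: conditional_entropy_eq_diff[OF X Y] entropy_eq_expectation[OF XY]
        entropy_eq_expectation[OF Y] integrable_log_pointmass[OF XY] integrable_log_pointmass[OF Y])
  then have "AE \<omega> in M. log b (pointmass Y \<omega>) - log b (pointmass ?XY \<omega>) = 0"
    using integral_nonneg_eq_0_iff_AE[OF int nn] by simp
  then have eq: "AE \<omega> in M. pointmass Y \<omega> = pointmass ?XY \<omega>"
    using AE_pointmass_pos[OF XY] AE_pointmass_pos[OF Y]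
    by eventually_elim (use b_gt_1 in \<open>simp add: log_def\<close>)
  define f where "f y = (SOME x. 0 < prob (?XY -` {(x, y)} \<inter> space M) \<and>
     prob (Y -` {y} \<inter> space M) = prob (?XY -` {(x, y)} \<inter> space M))" for y
  have "AE \<omega> in M. X \<omega> = f (Y \<omega>)"
    using eq AE_pointmass_pos[OF XY]
  proof eventually_elim
    case (elim \<omega>)
    let ?x = "X \<omega>" and ?y = "Y \<omega>" and ?x' = "f (Y \<omega>)"
    have f: "0 < prob (?XY -` {(?x', ?y)} \<inter> space M) \<and>
     prob (Y -` {?y} \<inter> space M) = prob (?XY -` {(?x', ?y)} \<inter> space M)"
      unfolding f_def by (rule someI[of _ ?x]) (use elim in \<open>auto simp: pointmass_def\<close>)
    show ?case
    proof (rule ccontr)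
      assume ne: "?x \<noteq> ?x'"
      have "prob (?XY -` {(?x, ?y)} \<inter> space M) + prob (?XY -` {(?x', ?y)} \<inter> space M) =
        prob ((?XY -` {(?x, ?y)} \<inter> space M) \<union> (?XY -` {(?x', ?y)} \<inter> space M))"
        using simple_functionD(2)[OF XY] ne by (intro finite_measure_Union[symmetric]) auto
      also have "\<dots> \<le> prob (Y -` {?y} \<inter> space M)"
        using simple_functionD(2)[OF Y] by (intro finite_measure_mono) auto
      finally show False using elim f by (simp add: pointmass_def)
    qed
  qed
  then show ?thesis by blast
qed

end

text \<open>Entropy depends on the law alone. The ranges may differ in values of probability zero,
  so both sums are compared over the union of the ranges.\<close>

lemma entropy_eq_of_law:
  assumes M: "information_space M b" and N: "information_space N b"
    and X: "simple_function M X" and Y: "simple_function N Y"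
    and law: "\<And>x. measure M {\<omega>\<in>space M. X \<omega> = x} = measure N {\<omega>\<in>space N. Y \<omega> = x}"
  shows "ent b M X = ent b N Y"
proof -
  interpret M: information_space M b by fact
  interpret N: information_space N b by fact
  have eq: "(\<lambda>x. measure M (X -` {x} \<inter> space M)) = (\<lambda>x. measure N (Y -` {x} \<inter> space N))"
    using law by (simp add: fun_eq_iff vimage_def Int_def conj_commute)
  let ?f = "\<lambda>x. measure N (Y -` {x} \<inter> space N) * log b (measure N (Y -` {x} \<inter> space N))"
  have e: "Y -` {x} \<inter> space N = {}" if "x \<notin> Y ` space N" for x using that by auto
  have e': "X -` {x} \<inter> space M = {}" if "x \<notin> X ` space M" for x using that by auto
  have "ent b M X = - (\<Sum>x\<in>X ` space M. ?f x)"
    using M.entropy_simple_distributed[OF M.simple_distributedI[OF X measure_nonneg refl]] eq by (simp add: fun_eq_iff)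
  also have "(\<Sum>x\<in>X ` space M. ?f x) = (\<Sum>x\<in>X ` space M \<union> Y ` space N. ?f x)"
    using simple_functionD(1)[OF X] simple_functionD(1)[OF Y] fun_cong[OF eq]
    by (intro sum.mono_neutral_left) (auto simp: e' simp flip: fun_cong[OF eq])
  also have "\<dots> = (\<Sum>x\<in>Y ` space N. ?f x)"
    using simple_functionD(1)[OF X] simple_functionD(1)[OF Y]
    by (intro sum.mono_neutral_right) (auto simp: e)
  also have "- \<dots> = ent b N Y"
    using N.entropy_simple_distributed[OF N.simple_distributedI[OF Y measure_nonneg refl]] by simp
  finally show ?thesis .
qed

section \<open>Independent variables and interactive discussions\<close>

context information_space
begin

text \<open>With d L = -H(T | W L), a summand d (B C) - d J0 is I(T; W (B C) | W J0), and the right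
  side is p H(T | W J0). Indices outside \<open>J0\<close> are added one at a time: the gain of an
  index j within \<open>B C\<close> is at most its gain over all indices added so far, and at most p
  blocks contain j. \<open>indep\<close> is an inequality because its converse is
  subadditivity.\<close>

lemma independent_cover_information_le:
  fixes Y :: "'j \<Rightarrow> 'a \<Rightarrow> 'y" and T :: "'a \<Rightarrow> 't" and B :: "'c \<Rightarrow> 'j set" and p :: nat
  assumes J: "finite J" and Y: "\<And>j. j \<in> J \<Longrightarrow> simple_function M (Y j)" and T: "simple_function M T"
    and indep: "(\<Sum>j\<in>J. \<H>(Y j)) \<le> \<H>(\<lambda>\<omega>. \<lambda>j\<in>J. Y j \<omega>)"
    and P: "finite P" and B: "\<And>C. C \<in> P \<Longrightarrow> J0 \<subseteq> B C \<and> B C \<subseteq> J" and J0: "J0 \<subseteq> J"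
    and cover: "\<And>j. j \<in> J - J0 \<Longrightarrow> card {C\<in>P. j \<in> B C} \<le> p"
  defines "W \<equiv> \<lambda>L \<omega>. \<lambda>j\<in>L. Y j \<omega>"
  shows "(\<Sum>C\<in>P. (\<H>(W (B C)) - \<H>(\<lambda>\<omega>. (T \<omega>, W (B C) \<omega>))) - (\<H>(W J0) - \<H>(\<lambda>\<omega>. (T \<omega>, W J0 \<omega>))))
    \<le> real p * (\<H>(\<lambda>\<omega>. (T \<omega>, W J0 \<omega>)) - \<H>(W J0))"
proof -
  have W: "simple_function M (W L)" if "L \<subseteq> J" for L
    unfolding W_def using that Y J by (intro simple_function_restrict) (auto intro: finite_subset)
  note sfs = simple_function_Pair W T Y
  \<comment> \<open>\<open>d L = - H(T | W L)\<close> is supermodular because \<open>H(W L)\<close> is modular\<close>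
  define d where "d L = \<H>(W L) - \<H>(\<lambda>\<omega>. (T \<omega>, W L \<omega>))" for L
  \<comment> \<open>A strict loss in subadditivity on \<open>L\<close>, combined with subadditivity
    on \<open>J - L\<close>, would be a loss on all of \<open>J\<close>, which \<open>indep\<close>
    excludes.\<close>
  have modular: "\<H>(W L) = (\<Sum>j\<in>L. \<H>(Y j))" if L: "L \<subseteq> J" for L
  proof (rule antisym)
    have fin: "finite L" using L J finite_subset by auto
    have le: "\<H>(W L') \<le> (\<Sum>j\<in>L'. \<H>(Y j))" if "L' \<subseteq> J" for L'
      unfolding W_def using that J Y by (intro entropy_restrict_le_sum) (auto intro: finite_subset)
    show "\<H>(W L) \<le> (\<Sum>j\<in>L. \<H>(Y j))" by (rule le[OF L])
    have "(\<Sum>j\<in>J. \<H>(Y j)) \<le> \<H>(W J)" using indep unfolding W_def .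
    also have "\<dots> \<le> \<H>(\<lambda>\<omega>. (W L \<omega>, W (J - L) \<omega>))"
    proof (rule entropy_mono[where f="\<lambda>(x, y). \<lambda>j\<in>J. if j \<in> L then x j else y j"])
      show "simple_function M (W J)" "simple_function M (\<lambda>\<omega>. (W L \<omega>, W (J - L) \<omega>))"
        by (rule W[OF subset_refl], rule simple_function_Pair[OF W[OF L] W[OF Diff_subset]])
    qed (use L in \<open>auto simp: W_def fun_eq_iff restrict_def\<close>)
    also have "\<dots> \<le> \<H>(W L) + \<H>(W (J - L))"
      by (rule entropy_subadditive[OF W[OF L] W[OF Diff_subset]])
    also have "\<H>(W (J - L)) \<le> (\<Sum>j\<in>J - L. \<H>(Y j))" by (rule le) auto
    also have "(\<Sum>j\<in>J. \<H>(Y j)) = (\<Sum>j\<in>L. \<H>(Y j)) + (\<Sum>j\<in>J - L. \<H>(Y j))"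
      using sum.subset_diff[OF L J, of "\<lambda>j. \<H>(Y j)"] by simp
    finally show "(\<Sum>j\<in>L. \<H>(Y j)) \<le> \<H>(W L)" by simp
  qed
  have mod_step: "\<H>(W (insert j L)) = \<H>(Y j) + \<H>(W L)" if "insert j L \<subseteq> J" "j \<notin> L" for j L
    using that finite_subset[OF _ J, of L] by (simp add: modular)
  have d_mono: "d L \<le> d (insert j L)" if L: "insert j L \<subseteq> J" "j \<notin> L" for j L
  proof -
    have j: "j \<in> J" "L \<subseteq> J" using L by auto
    note sf = Y[OF j(1)] W[OF j(2)] T W[OF L(1)]
    have "\<H>(\<lambda>\<omega>. (T \<omega>, W (insert j L) \<omega>)) \<le> \<H>(\<lambda>\<omega>. (Y j \<omega>, (T \<omega>, W L \<omega>)))"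
      by (rule entropy_mono[where f="\<lambda>(y, t, w). (t, \<lambda>i\<in>insert j L. if i = j then y else w i)"],
          (rule simple_function_Pair sf)+) (use L in \<open>auto simp: W_def fun_eq_iff\<close>)
    also have "\<dots> \<le> \<H>(Y j) + \<H>(\<lambda>\<omega>. (T \<omega>, W L \<omega>))"
      by (intro entropy_subadditive sf simple_function_Pair)
    finally show ?thesis using mod_step[OF L] by (simp add: d_def)
  qed
  \<comment> \<open>This is I(Y j; W L | T, W L') \<ge> 0 rewritten; the terms H(Y j) cancel by
    modularity.\<close>
  have d_super: "d (insert j L') - d L' \<le> d (insert j L) - d L"
    if L: "insert j L \<subseteq> J" "j \<notin> L" "L' \<subseteq> L" for j L L'
  proof -
    have j: "j \<in> J" "L \<subseteq> J" "L' \<subseteq> J" "insert j L' \<subseteq> J" "j \<notin> L'" using L by auto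
    note sf = Y[OF j(1)] W[OF j(2)] W[OF j(3)] W[OF j(4)] T W[OF L(1)]
    have 1: "\<H>(\<lambda>\<omega>. (T \<omega>, W (insert j L) \<omega>)) \<le> \<H>(\<lambda>\<omega>. (Y j \<omega>, W L \<omega>, T \<omega>, W L' \<omega>))"
      by (rule entropy_mono[where f="\<lambda>(y, w, t, _). (t, \<lambda>i\<in>insert j L. if i = j then y else w i)"],
          (rule simple_function_Pair sf)+) (use L in \<open>auto simp: W_def fun_eq_iff\<close>)
    have 2: "\<H>(\<lambda>\<omega>. (Y j \<omega>, W L \<omega>, T \<omega>, W L' \<omega>)) + \<H>(\<lambda>\<omega>. (T \<omega>, W L' \<omega>))
      \<le> \<H>(\<lambda>\<omega>. (Y j \<omega>, T \<omega>, W L' \<omega>)) + \<H>(\<lambda>\<omega>. (W L \<omega>, T \<omega>, W L' \<omega>))"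
      by (intro entropy_submodular sf simple_function_Pair)
    have 3: "\<H>(\<lambda>\<omega>. (Y j \<omega>, T \<omega>, W L' \<omega>)) \<le> \<H>(\<lambda>\<omega>. (T \<omega>, W (insert j L') \<omega>))"
      by (rule entropy_mono[where f="\<lambda>(t, w). (w j, t, \<lambda>i\<in>L'. w i)"],
          (rule simple_function_Pair sf)+) (use L in \<open>auto simp: W_def fun_eq_iff\<close>)
    have 4: "\<H>(\<lambda>\<omega>. (W L \<omega>, T \<omega>, W L' \<omega>)) \<le> \<H>(\<lambda>\<omega>. (T \<omega>, W L \<omega>))"
      by (rule entropy_mono[where f="\<lambda>(t, w). (w, t, \<lambda>i\<in>L'. w i)"],
          (rule simple_function_Pair sf)+) (use L in \<open>auto simp: W_def fun_eq_iff\<close>)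
    from 1 2 3 4 mod_step[OF L(1,2)] mod_step[OF j(4,5)] show ?thesis by (simp add: d_def)
  qed
  have main: "(\<Sum>C\<in>P. d (J0 \<union> (B C \<inter> L)) - d J0) \<le> real p * (d (J0 \<union> L) - d J0)"
    if "finite L" "L \<subseteq> J - J0" for L
    using that
  proof (induction L rule: finite_induct)
    case (insert j L)
    let ?\<delta> = "d (insert j (J0 \<union> L)) - d (J0 \<union> L)"
    have jL: "insert j (J0 \<union> L) \<subseteq> J" "j \<notin> J0 \<union> L" using insert J0 by auto
    have "(\<Sum>C\<in>P. d (J0 \<union> (B C \<inter> insert j L)) - d J0)
      \<le> (\<Sum>C\<in>P. (d (J0 \<union> (B C \<inter> L)) - d J0) + (if j \<in> B C then ?\<delta> else 0))"
    proof (intro sum_mono)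
      fix C assume "C \<in> P"
      show "d (J0 \<union> (B C \<inter> insert j L)) - d J0 \<le> (d (J0 \<union> (B C \<inter> L)) - d J0) + (if j \<in> B C then ?\<delta> else 0)"
        using d_super[OF jL Un_mono[OF subset_refl Int_lower2], of "B C"]
        by (auto simp: Int_insert_right)
    qed
    also have "\<dots> = (\<Sum>C\<in>P. d (J0 \<union> (B C \<inter> L)) - d J0) + real (card {C\<in>P. j \<in> B C}) * ?\<delta>"
      using P by (simp add: sum.distrib sum.If_cases Int_def)
    \<comment> \<open>The gain is nonnegative by \<open>d_mono\<close>, so the number of blocks
      containing j may be raised to p.\<close>
    also have "\<dots> \<le> real p * (d (J0 \<union> L) - d J0) + real p * ?\<delta>"
      using insert cover[of j] d_mono[OF jL] by (intro add_mono mult_right_mono) auto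
    finally show ?case by (simp add: algebra_simps)
  qed simp
  have "J0 \<union> (B C \<inter> (J - J0)) = B C" if "C \<in> P" for C using B[OF that] by auto
  then have "(\<Sum>C\<in>P. d (B C) - d J0) \<le> real p * (d J - d J0)"
    using main[of "J - J0"] J J0 by (simp add: Un_absorb1)
  \<comment> \<open>H(T | W J) \<ge> 0, that is, d J \<le> 0.\<close>
  also have "\<dots> \<le> real p * (0 - d J0)"
  proof -
    have "\<H>(W J) \<le> \<H>(\<lambda>\<omega>. (T \<omega>, W J \<omega>))"
      by (rule entropy_mono[where f=snd]) (auto intro!: sfs)
    then show ?thesis by (intro mult_left_mono) (auto simp: d_def)
  qed
  finally show ?thesis by (simp add: d_def algebra_simps)
qed

text \<open>A new message adds nothing to H(hist | W C) in the block of its speaker, and in any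
  other block at most its entropy given the past and \<open>G\<close>; hence the factor |P| - 1.
  Since \<open>G\<close> is a function of each \<open>W C\<close>, the claim says that the sum of
  I(W C; hist | G) is at least H(hist | G).\<close>

lemma interactive_discussion_le:
  fixes hist :: "nat \<Rightarrow> 'a \<Rightarrow> 'h" and G :: "'a \<Rightarrow> 'g" and W :: "'c \<Rightarrow> 'a \<Rightarrow> 'w"
  assumes hist: "\<And>t. simple_function M (hist t)" and G: "simple_function M G"
    and P: "finite P" and W: "\<And>C. C \<in> P \<Longrightarrow> simple_function M (W C)"
    and GW: "\<And>C \<omega>. C \<in> P \<Longrightarrow> \<omega> \<in> space M \<Longrightarrow> G \<omega> = g C (W C \<omega>)"
    and sp: "\<And>t. sp t \<in> P"
    and hist0: "\<And>\<omega>. \<omega> \<in> space M \<Longrightarrow> hist 0 \<omega> = h0"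
    and hist_Suc: "\<And>t. AE \<omega> in M. hist (Suc t) \<omega> = st t (hist t \<omega>) (W (sp t) \<omega>)"
    and hist_prev: "\<And>t \<omega>. \<omega> \<in> space M \<Longrightarrow> hist t \<omega> = pr t (hist (Suc t) \<omega>)"
  shows "(\<Sum>C\<in>P. \<H>(\<lambda>\<omega>. (hist t \<omega>, W C \<omega>)) - \<H>(W C))
    \<le> (real (card P) - 1) * (\<H>(\<lambda>\<omega>. (hist t \<omega>, G \<omega>)) - \<H>(G))"
proof (induction t)
  case 0
  have "(\<Sum>C\<in>P. \<H>(\<lambda>\<omega>. (hist 0 \<omega>, W C \<omega>)) - \<H>(W C)) \<le> (\<Sum>C\<in>P. 0)"
  proof (intro sum_mono)
    fix C assume "C \<in> P"
    then have "\<H>(\<lambda>\<omega>. (hist 0 \<omega>, W C \<omega>)) \<le> \<H>(W C)"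
      by (intro entropy_mono[where f="Pair h0"]) (auto intro!: simple_function_Pair hist W hist0)
    then show "\<H>(\<lambda>\<omega>. (hist 0 \<omega>, W C \<omega>)) - \<H>(W C) \<le> 0" by simp
  qed
  also have "\<dots> \<le> (real (card P) - 1) * (\<H>(\<lambda>\<omega>. (hist 0 \<omega>, G \<omega>)) - \<H>(G))"
  proof -
    have "\<H>(G) \<le> \<H>(\<lambda>\<omega>. (hist 0 \<omega>, G \<omega>))"
      by (rule entropy_mono[where f=snd]) (auto intro!: simple_function_Pair hist G)
    moreover have "card P \<noteq> 0" using sp P by auto
    ultimately show ?thesis by simp
  qed
  finally show ?case .
next
  case (Suc t)
  let ?\<delta> = "\<H>(\<lambda>\<omega>. (hist (Suc t) \<omega>, G \<omega>)) - \<H>(\<lambda>\<omega>. (hist t \<omega>, G \<omega>))"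
  have step: "\<H>(\<lambda>\<omega>. (hist (Suc t) \<omega>, W C \<omega>)) - \<H>(\<lambda>\<omega>. (hist t \<omega>, W C \<omega>)) \<le> (if C = sp t then 0 else ?\<delta>)"
    if C: "C \<in> P" for C
  proof (cases "C = sp t")
    case True
    have "\<H>(\<lambda>\<omega>. (hist (Suc t) \<omega>, W C \<omega>)) \<le> \<H>(\<lambda>\<omega>. (hist t \<omega>, W C \<omega>))"
      by (rule entropy_mono_AE[where f="\<lambda>(h, w). (st t h w, w)"])
         (use hist_Suc[of t] in \<open>auto intro!: simple_function_Pair hist W C simp: True sp\<close>)
    then show ?thesis using True by simp
  next
    case False
    \<comment> \<open>Conditioning on \<open>W C\<close> besides \<open>?Z\<close> cannot raise the
      entropy of the new history. As \<open>W C\<close> determines \<open>G\<close> and the new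
      history determines the old one, the redundant components of \<open>?Z\<close> drop out
      again.\<close>
    let ?Z = "\<lambda>\<omega>. (hist t \<omega>, G \<omega>)"
    note sf = hist[of "Suc t"] hist[of t] W[OF C] G
    have "\<H>(\<lambda>\<omega>. (hist (Suc t) \<omega>, W C \<omega>, ?Z \<omega>)) + \<H>(?Z) \<le> \<H>(\<lambda>\<omega>. (hist (Suc t) \<omega>, ?Z \<omega>)) + \<H>(\<lambda>\<omega>. (W C \<omega>, ?Z \<omega>))"
      by (intro entropy_submodular simple_function_Pair sf)
    moreover have "\<H>(\<lambda>\<omega>. (hist (Suc t) \<omega>, W C \<omega>)) \<le> \<H>(\<lambda>\<omega>. (hist (Suc t) \<omega>, W C \<omega>, ?Z \<omega>))"
      by (rule entropy_mono[where f="\<lambda>(h, w, _). (h, w)"]) (auto intro!: simple_function_Pair sf)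
    moreover have "\<H>(\<lambda>\<omega>. (hist (Suc t) \<omega>, ?Z \<omega>)) \<le> \<H>(\<lambda>\<omega>. (hist (Suc t) \<omega>, G \<omega>))"
      by (rule entropy_mono[where f="\<lambda>(h, w). (h, pr t h, w)"])
         (auto intro!: simple_function_Pair sf hist_prev)
    moreover have "\<H>(\<lambda>\<omega>. (W C \<omega>, ?Z \<omega>)) \<le> \<H>(\<lambda>\<omega>. (hist t \<omega>, W C \<omega>))"
      by (rule entropy_mono[where f="\<lambda>(h, w). (w, h, g C w)"])
         (auto intro!: simple_function_Pair sf GW C)
    ultimately show ?thesis using False by simp
  qed
  have "(\<Sum>C\<in>P. \<H>(\<lambda>\<omega>. (hist (Suc t) \<omega>, W C \<omega>)) - \<H>(W C)) =
     (\<Sum>C\<in>P. \<H>(\<lambda>\<omega>. (hist t \<omega>, W C \<omega>)) - \<H>(W C)) +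
     (\<Sum>C\<in>P. \<H>(\<lambda>\<omega>. (hist (Suc t) \<omega>, W C \<omega>)) - \<H>(\<lambda>\<omega>. (hist t \<omega>, W C \<omega>)))"
    by (simp add: sum.distrib[symmetric])
  also have "\<dots> \<le> (real (card P) - 1) * (\<H>(\<lambda>\<omega>. (hist t \<omega>, G \<omega>)) - \<H>(G)) +
     (\<Sum>C\<in>P. if C = sp t then 0 else ?\<delta>)"
    by (intro add_mono Suc sum_mono step)
  also have "(\<Sum>C\<in>P. if C = sp t then 0 else ?\<delta>) = (\<Sum>C\<in>P - {sp t}. ?\<delta>)"
    using P by (intro sum.mono_neutral_cong_right) auto
  also have "\<dots> = (real (card P) - 1) * ?\<delta>"
  proof -
    have "card P \<noteq> 0" using sp P by auto
    then have "real (card (P - {sp t})) = real (card P) - 1"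
      using P sp[of t] by (simp add: of_nat_diff Suc_le_eq card_gt_0_iff)
    then show ?thesis by simp
  qed
  finally show ?case by (simp add: algebra_simps)
qed

lemma secret_key_bound:
  fixes Y :: "'j \<Rightarrow> 'a \<Rightarrow> 'y" and K :: "'a \<Rightarrow> 'k" and hist :: "nat \<Rightarrow> 'a \<Rightarrow> 'h"
    and B :: "'c \<Rightarrow> 'j set" and p :: nat
  assumes J: "finite J" and Y: "\<And>j. j \<in> J \<Longrightarrow> simple_function M (Y j)"
    and indep: "(\<Sum>j\<in>J. \<H>(Y j)) \<le> \<H>(\<lambda>\<omega>. \<lambda>j\<in>J. Y j \<omega>)"
    and P: "finite P" and B: "\<And>C. C \<in> P \<Longrightarrow> J0 \<subseteq> B C \<and> B C \<subseteq> J"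
    and cover: "\<And>j. j \<in> J - J0 \<Longrightarrow> card {C\<in>P. j \<in> B C} \<le> p" and p: "1 \<le> p" "p \<le> card P"
    and hist: "\<And>t. simple_function M (hist t)" and sp: "\<And>t. sp t \<in> P"
    and hist0: "\<And>\<omega>. \<omega> \<in> space M \<Longrightarrow> hist 0 \<omega> = h0"
    and hist_Suc: "\<And>t. AE \<omega> in M. hist (Suc t) \<omega> = st t (hist t \<omega>) (\<lambda>j\<in>B (sp t). Y j \<omega>)"
    and hist_prev: "\<And>t \<omega>. \<omega> \<in> space M \<Longrightarrow> hist t \<omega> = pr t (hist (Suc t) \<omega>)"
    and K: "simple_function M K"
    and recover: "\<And>C. C \<in> P \<Longrightarrow> \<H>(\<lambda>\<omega>. (K \<omega>, hist t \<omega>, \<lambda>j\<in>B C. Y j \<omega>))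
      \<le> \<H>(\<lambda>\<omega>. (hist t \<omega>, \<lambda>j\<in>B C. Y j \<omega>)) + \<epsilon>"
  shows "(real (card P) - real p) * (\<H>(\<lambda>\<omega>. (K \<omega>, hist t \<omega>)) - \<H>(hist t) - \<H>(\<lambda>\<omega>. \<lambda>j\<in>J0. Y j \<omega>))
    \<le> (real p - 1) * \<H>(hist t) + real (card P) * \<epsilon>"
proof -
  have J0: "J0 \<subseteq> J" using B[OF sp[of 0]] by auto
  let ?W = "\<lambda>L \<omega>. \<lambda>j\<in>L. Y j \<omega>" and ?F = "hist t"
  let ?G = "?W J0" and ?T = "\<lambda>\<omega>. (K \<omega>, ?F \<omega>)"
  have W: "simple_function M (?W L)" if "L \<subseteq> J" for L
    using that Y J by (intro simple_function_restrict) (auto intro: finite_subset)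
  have T: "simple_function M ?T" by (intro simple_function_Pair K hist)
  note sf = W[OF J0] hist[of t] K
  \<comment> \<open>\<open>a\<close> is H(F | G) and \<open>\<kappa>\<close> is H(K | F, G), so H(K,
    F | G) = a + \<kappa>.\<close>
  define a where "a = \<H>(\<lambda>\<omega>. (?F \<omega>, ?G \<omega>)) - \<H>(?G)"
  define \<kappa> where "\<kappa> = \<H>(\<lambda>\<omega>. (?T \<omega>, ?G \<omega>)) - \<H>(\<lambda>\<omega>. (?F \<omega>, ?G \<omega>))"
  have a: "a \<le> \<H>(?F)" using entropy_subadditive[OF sf(2,1)] by (simp add: a_def)
  have "\<H>(?T) \<le> \<H>(\<lambda>\<omega>. (?T \<omega>, ?G \<omega>))"
    by (rule entropy_mono[where f=fst]) (auto intro!: simple_function_Pair sf)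
  \<comment> \<open>Conditioning on \<open>G\<close> lowers H(K | F) by at most H(G).\<close>
  then have \<kappa>: "\<H>(?T) - \<H>(?F) - \<H>(?G) \<le> \<kappa>" using a by (simp add: a_def \<kappa>_def)
  have "(\<Sum>C\<in>P. (\<H>(?W (B C)) - \<H>(\<lambda>\<omega>. (?T \<omega>, ?W (B C) \<omega>))) - (\<H>(?G) - \<H>(\<lambda>\<omega>. (?T \<omega>, ?G \<omega>))))
    \<le> real p * (\<H>(\<lambda>\<omega>. (?T \<omega>, ?G \<omega>)) - \<H>(?G))"
    using J Y T indep P B J0 cover by (rule independent_cover_information_le)
  then have "(\<Sum>C\<in>P. \<H>(?W (B C)) - \<H>(\<lambda>\<omega>. (?T \<omega>, ?W (B C) \<omega>))) + real (card P) * (a + \<kappa>) \<le> real p * (a + \<kappa>)"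
    by (simp add: a_def \<kappa>_def sum_subtractf sum.distrib algebra_simps del: restrict_apply)
  moreover have "(\<Sum>C\<in>P. \<H>(?W (B C)) - (\<H>(\<lambda>\<omega>. (?F \<omega>, ?W (B C) \<omega>)) + \<epsilon>)) \<le> (\<Sum>C\<in>P. \<H>(?W (B C)) - \<H>(\<lambda>\<omega>. (?T \<omega>, ?W (B C) \<omega>)))"
  proof (intro sum_mono diff_left_mono)
    fix C assume C: "C \<in> P"
    then have sfC: "simple_function M (?W (B C))" using B by (intro W) auto
    have "\<H>(\<lambda>\<omega>. (?T \<omega>, ?W (B C) \<omega>)) \<le> \<H>(\<lambda>\<omega>. (K \<omega>, ?F \<omega>, ?W (B C) \<omega>))"
      by (rule entropy_mono[where f="\<lambda>(k, f, w). ((k, f), w)"]) (auto intro!: simple_function_Pair sf sfC)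
    also note recover[OF C]
    finally show "\<H>(\<lambda>\<omega>. (?T \<omega>, ?W (B C) \<omega>)) \<le> \<H>(\<lambda>\<omega>. (?F \<omega>, ?W (B C) \<omega>)) + \<epsilon>" .
  qed
  moreover have "(\<Sum>C\<in>P. \<H>(\<lambda>\<omega>. (?F \<omega>, ?W (B C) \<omega>)) - \<H>(?W (B C))) \<le> (real (card P) - 1) * a"
    unfolding a_def
  proof (rule interactive_discussion_le[where g="\<lambda>_ w. \<lambda>j\<in>J0. w j" and W="\<lambda>C. ?W (B C)" and sp=sp and st=st and pr=pr])
    show "simple_function M (?W (B C))" if "C \<in> P" for C using B that by (intro W) auto
    show "?G \<omega> = (\<lambda>j\<in>J0. ?W (B C) \<omega> j)" if "C \<in> P" for C \<omega> using B[OF that] by (auto simp: fun_eq_iff)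
  qed (fact hist sf P sp hist0 hist_Suc hist_prev)+
  \<comment> \<open>The covering bound has |P| a on the left and p a on the right, and the
    discussion bound takes back only (|P| - 1) a; so p - 1 copies of \<open>a\<close>
    survive.\<close>
  ultimately have "(real (card P) - real p) * \<kappa> \<le> (real p - 1) * a + real (card P) * \<epsilon>"
    by (simp add: sum_subtractf sum.distrib algebra_simps del: restrict_apply)
  moreover have "(real p - 1) * a \<le> (real p - 1) * \<H>(?F)"
    using a p by (intro mult_left_mono) auto
  moreover have "(real (card P) - real p) * (\<H>(?T) - \<H>(?F) - \<H>(?G)) \<le> (real (card P) - real p) * \<kappa>"
    using \<kappa> p by (intro mult_left_mono) auto
  ultimately show ?thesis by (simp del: restrict_apply)
qed

end

section \<open>Edge variables as functions of the source\<close>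

lemma simple_function_count_space_finite:
  assumes "finite S" "X \<in> measurable M (count_space S)"
  shows "simple_function M X"
  unfolding simple_function_def
proof (intro conjI ballI)
  show "finite (X ` space M)"
    using measurable_space[OF assms(2)] assms(1) by (auto intro: finite_subset[of _ S])
  fix x assume "x \<in> X ` space M"
  then show "X -` {x} \<inter> space M \<in> sets M"
    using measurable_space[OF assms(2)] by (auto intro!: measurable_sets[OF assms(2)])
qed

text \<open>Makes a random subset of a finite set a finitely-valued variable; the tables of possible
  responses are of this kind.\<close>

lemma simple_function_Collect:
  assumes Q: "finite Q" and "\<And>q. q \<in> Q \<Longrightarrow> {\<omega>\<in>space M. \<phi> q \<omega>} \<in> sets M"
  shows "simple_function M (\<lambda>\<omega>. {q\<in>Q. \<phi> q \<omega>})"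
  unfolding simple_function_def
proof (intro conjI ballI)
  show "finite ((\<lambda>\<omega>. {q\<in>Q. \<phi> q \<omega>}) ` space M)"
    using Q by (auto intro: finite_subset[of _ "Pow Q"])
  fix y
  have "(\<lambda>\<omega>. {q\<in>Q. \<phi> q \<omega>}) -` {y} \<inter> space M =
    {\<omega>\<in>space M. y \<subseteq> Q \<and> (\<forall>q\<in>Q. (q \<in> y \<longrightarrow> \<phi> q \<omega>) \<and> (q \<notin> y \<longrightarrow> \<not> \<phi> q \<omega>))}"
    by auto
  also have "\<dots> \<in> sets M"
    using assms by (intro sets.sets_Collect_conj sets.sets_Collect_finite_All
      sets.sets_Collect_imp sets.sets_Collect_neg sets.sets_Collect_const)
  finally show "(\<lambda>\<omega>. {q\<in>Q. \<phi> q \<omega>}) -` {y} \<inter> space M \<in> sets M" .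
qed

lemma PiM_count_space_eq:
  assumes "finite V" "\<And>i. i \<in> V \<Longrightarrow> finite (A i)"
  shows "PiM V (\<lambda>i. count_space (A i)) = count_space (PiE V A)"
proof -
  \<comment> \<open>Outside \<open>V\<close> the alphabets are arbitrary; the empty set makes every
    factor countable.\<close>
  let ?A = "\<lambda>i. if i \<in> V then A i else {}"
  have "PiM V (\<lambda>i. count_space (A i)) = PiM V (\<lambda>i. count_space (?A i))"
    by (intro PiM_cong) auto
  also have "\<dots> = count_space (PiE V ?A)"
    using assms by (intro count_space_PiM_finite) (auto intro: countable_finite)
  also have "PiE V ?A = PiE V A" by (intro PiE_cong) auto
  finally show ?thesis .
qed

lemma (in prob_space) sum_prob_eq_le_1:
  assumes S: "finite S" and X: "simple_function M X"
  shows "(\<Sum>v\<in>S. prob {\<omega>\<in>space M. X \<omega> = v}) \<le> 1"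
proof -
  have ev: "{\<omega>\<in>space M. X \<omega> = v} \<in> events" for v
    using simple_functionD(2)[OF X, of "{v}"] by (simp add: vimage_def Int_def conj_commute)
  have "(\<Sum>v\<in>S. prob {\<omega>\<in>space M. X \<omega> = v}) = prob (\<Union>v\<in>S. {\<omega>\<in>space M. X \<omega> = v})"
    using S ev by (intro finite_measure_finite_Union[symmetric]) (auto simp: disjoint_family_on_def)
  also have "\<dots> \<le> 1" by simp
  finally show ?thesis .
qed

text \<open>Vanishing conditional entropies give functions in both directions, almost surely. An
  edge is nonempty, so its variable can be read off the observation of one chosen member
  \<open>i0 e\<close>. As a function \<open>x e\<close> of a source symbol it still makes sense on
  spaces where \<open>X e\<close> does not exist.\<close>

lemma edge_functions_exist:
  fixes M :: "'a measure" and Z :: "nat \<Rightarrow> 'a \<Rightarrow> 'z" and X :: "'e \<Rightarrow> 'a \<Rightarrow> 'x"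
  assumes b: "1 < b" and "prob_space M" and V: "finite V"
    and A: "\<And>i. i \<in> V \<Longrightarrow> finite (A i)"
    and Z: "\<And>i. i \<in> V \<Longrightarrow> Z i \<in> measurable M (count_space (A i))"
    and hyp: "hypergraphical b M V Z E \<xi> X"
  obtains x :: "'e \<Rightarrow> (nat \<Rightarrow> 'z) \<Rightarrow> 'x" and k :: "nat \<Rightarrow> ('e \<Rightarrow> 'x) \<Rightarrow> 'z" where
    "AE \<omega> in M. \<forall>e\<in>E. x e (\<lambda>i\<in>V. Z i \<omega>) = X e \<omega>"
    "AE \<omega> in M. \<forall>i\<in>V. Z i \<omega> = k i (\<lambda>e\<in>{e\<in>E. i \<in> \<xi> e}. X e \<omega>)"
proof -
  interpret information_space M b
    using assms(1,2) by (intro information_space.intro information_space_axioms.intro)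
  let ?W = "\<lambda>i \<omega>. \<lambda>e\<in>{e\<in>E. i \<in> \<xi> e}. X e \<omega>"
  from hyp have E: "finite E" and \<xi>: "\<And>e. e \<in> E \<Longrightarrow> \<xi> e \<subseteq> V \<and> \<xi> e \<noteq> {}"
    and X: "\<And>e. e \<in> E \<Longrightarrow> simple_function M (X e)"
    and eq: "\<And>i. i \<in> V \<Longrightarrow> \<H>(Z i | ?W i) = 0 \<and> \<H>(?W i | Z i) = 0"
    by (auto simp: hypergraphical_def equiv_up_to_bij_def)
  have sZ: "simple_function M (Z i)" if "i \<in> V" for i
    by (rule simple_function_count_space_finite[OF A[OF that] Z[OF that]])
  have sW: "simple_function M (?W i)" for i
    using E X by (intro simple_function_restrict) auto
  have "\<exists>k. AE \<omega> in M. Z i \<omega> = k (?W i \<omega>)" if "i \<in> V" for i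
    using conditional_entropy_0_imp_function[OF sZ[OF that] sW conjunct1[OF eq[OF that]]] .
  then have "\<forall>i\<in>V. \<exists>k. AE \<omega> in M. Z i \<omega> = k (?W i \<omega>)" by blast
  from bchoice[OF this] obtain k where k: "\<And>i. i \<in> V \<Longrightarrow> AE \<omega> in M. Z i \<omega> = k i (?W i \<omega>)" by blast
  have "\<exists>g. AE \<omega> in M. ?W i \<omega> = g (Z i \<omega>)" if "i \<in> V" for i
    using conditional_entropy_0_imp_function[OF sW sZ[OF that] conjunct2[OF eq[OF that]]] .
  then have "\<forall>i\<in>V. \<exists>g. AE \<omega> in M. ?W i \<omega> = g (Z i \<omega>)" by blast
  from bchoice[OF this] obtain g where g: "\<And>i. i \<in> V \<Longrightarrow> AE \<omega> in M. ?W i \<omega> = g i (Z i \<omega>)" by blast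
  have "\<forall>e\<in>E. \<exists>i. i \<in> \<xi> e" using \<xi> by blast
  from bchoice[OF this] obtain i0 where i0: "\<And>e. e \<in> E \<Longrightarrow> i0 e \<in> \<xi> e" by blast
  define x where "x e z = g (i0 e) (z (i0 e)) e" for e z
  have "AE \<omega> in M. \<forall>e\<in>E. x e (\<lambda>i\<in>V. Z i \<omega>) = X e \<omega>"
  proof (rule AE_finite_allI[OF E])
    fix e assume e: "e \<in> E"
    then have V: "i0 e \<in> V" using i0 \<xi> by auto
    from g[OF V] show "AE \<omega> in M. x e (\<lambda>i\<in>V. Z i \<omega>) = X e \<omega>"
    proof eventually_elim
      case (elim \<omega>)
      have "x e (\<lambda>i\<in>V. Z i \<omega>) = ?W (i0 e) \<omega> e"
        unfolding elim x_def using V by simp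
      then show ?case using e i0[OF e] by simp
    qed
  qed
  moreover have "AE \<omega> in M. \<forall>i\<in>V. Z i \<omega> = k i (?W i \<omega>)"
    by (rule AE_finite_allI[OF V k])
  ultimately show thesis by (rule that)
qed

text \<open>The hypergraphical structure as a property of the law \<open>PZ\<close> alone, which is
  all that a scheme shares with the given source. \<open>edge_law\<close> is independence of the
  edges, and the conditions on \<open>\<mu>\<close> are those on the weights in Gibbs'
  inequality.\<close>

locale edge_source =
  fixes b :: real and V :: "nat set" and A :: "nat \<Rightarrow> 'z set" and PZ :: "(nat \<Rightarrow> 'z) measure"
    and E :: "'e set" and \<xi> :: "'e \<Rightarrow> nat set"
    and x :: "'e \<Rightarrow> (nat \<Rightarrow> 'z) \<Rightarrow> 'x" and k :: "nat \<Rightarrow> ('e \<Rightarrow> 'x) \<Rightarrow> 'z" and \<mu> :: "'e \<Rightarrow> 'x \<Rightarrow> real"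
  assumes base: "1 < b" and finite_V: "finite V" and finite_A: "\<And>i. i \<in> V \<Longrightarrow> finite (A i)"
    and prob_PZ: "prob_space PZ" and sets_PZ: "sets PZ = Pow (PiE V A)"
    and finite_E: "finite E"
    and edges: "AE z in PZ. \<forall>i\<in>V. z i = k i (\<lambda>e\<in>{e\<in>E. i \<in> \<xi> e}. x e z)"
    and edge_law: "\<And>y. measure PZ {z\<in>PiE V A. \<forall>e\<in>E. x e z = y e} = (\<Prod>e\<in>E. \<mu> e (y e))"
    and \<mu>_nonneg: "\<And>e v. e \<in> E \<Longrightarrow> 0 \<le> \<mu> e v"
    and \<mu>_le_1: "\<And>e S. e \<in> E \<Longrightarrow> finite S \<Longrightarrow> (\<Sum>v\<in>S. \<mu> e v) \<le> 1"

lemma edge_source_law: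
  fixes M :: "'a measure" and Z :: "nat \<Rightarrow> 'a \<Rightarrow> 'z" and X :: "'e \<Rightarrow> 'a \<Rightarrow> 'x"
  assumes b: "1 < b" and M: "prob_space M" and V: "finite V"
    and A: "\<And>i. i \<in> V \<Longrightarrow> finite (A i)"
    and Z: "\<And>i. i \<in> V \<Longrightarrow> Z i \<in> measurable M (count_space (A i))"
    and hyp: "hypergraphical b M V Z E \<xi> X"
  obtains x :: "'e \<Rightarrow> (nat \<Rightarrow> 'z) \<Rightarrow> 'x" and k :: "nat \<Rightarrow> ('e \<Rightarrow> 'x) \<Rightarrow> 'z" and \<mu> where
    "edge_source b V A (source_law V A M Z) E \<xi> x k \<mu>"
    "\<And>E'. E' \<subseteq> E \<Longrightarrow> ent b (source_law V A M Z) (\<lambda>z. \<lambda>e\<in>E'. x e z) = ent b M (\<lambda>\<omega>. \<lambda>e\<in>E'. X e \<omega>)"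
proof -
  interpret information_space M b
    using M b by (intro information_space.intro information_space_axioms.intro)
  let ?PZ = "source_law V A M Z" and ?Z = "\<lambda>\<omega>. \<lambda>i\<in>V. Z i \<omega>"
  from hyp have E: "finite E" and X: "\<And>e. e \<in> E \<Longrightarrow> simple_function M (X e)"
    and indep: "indep_vars (\<lambda>_. count_space UNIV) X E"
    by (auto simp: hypergraphical_def)
  obtain x :: "'e \<Rightarrow> (nat \<Rightarrow> 'z) \<Rightarrow> 'x" and k :: "nat \<Rightarrow> ('e \<Rightarrow> 'x) \<Rightarrow> 'z" where
    x: "AE \<omega> in M. \<forall>e\<in>E. x e (?Z \<omega>) = X e \<omega>" and
    k: "AE \<omega> in M. \<forall>i\<in>V. Z i \<omega> = k i (\<lambda>e\<in>{e\<in>E. i \<in> \<xi> e}. X e \<omega>)"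
    using edge_functions_exist[OF b M V A Z hyp] .
  define \<mu> where "\<mu> e v = prob {\<omega>\<in>space M. X e \<omega> = v}" for e v
  have PM: "PiM V (\<lambda>i. count_space (A i)) = count_space (PiE V A)"
    by (rule PiM_count_space_eq[OF V A])
  have Zm: "?Z \<in> measurable M (count_space (PiE V A))"
    unfolding PM[symmetric] using Z by (intro measurable_restrict)
  have PZ: "?PZ = distr M (count_space (PiE V A)) ?Z"
    by (simp add: source_law_def PM)
  have meas: "measure ?PZ {z\<in>PiE V A. Q z} = prob {\<omega>\<in>space M. Q (?Z \<omega>)}" for Q
    unfolding PZ by (subst measure_distr[OF Zm])
      (use measurable_space[OF Zm] in \<open>auto intro!: arg_cong[where f=prob]\<close>)
  have ev: "{\<omega>\<in>space M. Q (?Z \<omega>)} \<in> events" for Q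
  proof -
    have "{\<omega>\<in>space M. Q (?Z \<omega>)} = ?Z -` {z\<in>PiE V A. Q z} \<inter> space M"
      using measurable_space[OF Zm] by auto
    also have "\<dots> \<in> events" by (intro measurable_sets[OF Zm]) auto
    finally show ?thesis .
  qed
  have XJ: "simple_function M (\<lambda>\<omega>. \<lambda>e\<in>E'. X e \<omega>)" if "E' \<subseteq> E" for E'
    using that E X by (intro simple_function_restrict) (auto intro: finite_subset)
  have evX: "{\<omega>\<in>space M. \<forall>e\<in>E. X e \<omega> = y e} \<in> events" for y
  proof -
    have "{\<omega>\<in>space M. \<forall>e\<in>E. X e \<omega> = y e} = (\<lambda>\<omega>. \<lambda>e\<in>E. X e \<omega>) -` {restrict y E} \<inter> space M"
      by (auto simp: fun_eq_iff restrict_def; metis)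
    then show ?thesis using simple_functionD(2)[OF XJ[OF subset_refl]] by simp
  qed
  have "edge_source b V A ?PZ E \<xi> x k \<mu>"
  proof (rule edge_source.intro)
    show "prob_space ?PZ" unfolding PZ by (rule prob_space_distr[OF Zm])
    show "sets ?PZ = Pow (PiE V A)" unfolding PZ by simp
    show "AE z in ?PZ. \<forall>i\<in>V. z i = k i (\<lambda>e\<in>{e\<in>E. i \<in> \<xi> e}. x e z)"
      unfolding PZ
    proof (subst AE_distr_iff[OF Zm])
      show "AE \<omega> in M. \<forall>i\<in>V. ?Z \<omega> i = k i (\<lambda>e\<in>{e\<in>E. i \<in> \<xi> e}. x e (?Z \<omega>))"
        using x k
      proof eventually_elim
        case (elim \<omega>)
        have "(\<lambda>e\<in>{e\<in>E. i \<in> \<xi> e}. x e (?Z \<omega>)) = (\<lambda>e\<in>{e\<in>E. i \<in> \<xi> e}. X e \<omega>)" for i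
          using elim(1) by (intro restrict_ext) auto
        then show ?case using elim(2) by simp
      qed
    qed simp
    show "measure ?PZ {z\<in>PiE V A. \<forall>e\<in>E. x e z = y e} = (\<Prod>e\<in>E. \<mu> e (y e))" for y
    proof -
      have "measure ?PZ {z\<in>PiE V A. \<forall>e\<in>E. x e z = y e} = prob {\<omega>\<in>space M. \<forall>e\<in>E. X e \<omega> = y e}"
        unfolding meas using x by (intro finite_measure_eq_AE ev evX) auto
      also have "\<dots> = (\<Prod>e\<in>E. \<mu> e (y e))"
      \<comment> \<open>Without edges the event is the whole space and the product is 1; the product
        rule for independent variables is stated for a nonempty index set.\<close>
      proof (cases "E = {}")
        case True then show ?thesis by (simp add: prob_space)
      next
        case False
        have "{\<omega>\<in>space M. \<forall>e\<in>E. X e \<omega> = y e} = (\<Inter>e\<in>E. X e -` {y e} \<inter> space M)"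
          using False by auto
        then show ?thesis
          using indep_varsD_finite[OF indep False E, of "\<lambda>e. {y e}"]
          by (simp add: \<mu>_def vimage_def Int_def conj_commute)
      qed
      finally show ?thesis .
    qed
    show "0 \<le> \<mu> e v" for e v by (simp add: \<mu>_def)
    show "(\<Sum>v\<in>S. \<mu> e v) \<le> 1" if "e \<in> E" "finite S" for e S
      unfolding \<mu>_def using that X by (intro sum_prob_eq_le_1) auto
  qed (use b V A E in auto)
  moreover have "ent b ?PZ (\<lambda>z. \<lambda>e\<in>E'. x e z) = ent b M (\<lambda>\<omega>. \<lambda>e\<in>E'. X e \<omega>)" if E': "E' \<subseteq> E" for E'
  proof (rule entropy_eq_of_law)
    show "information_space M b" by unfold_locales
    show "information_space ?PZ b"
      using b prob_space_distr[OF Zm] by (simp add: PZ information_space_def information_space_axioms_def)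
    have fin: "finite (PiE V A)" using V A by (intro finite_PiE)
    show "simple_function ?PZ (\<lambda>z. \<lambda>e\<in>E'. x e z)"
      unfolding PZ simple_function_def using fin by auto
    show "simple_function M (\<lambda>\<omega>. \<lambda>e\<in>E'. X e \<omega>)" by (rule XJ[OF E'])
    fix y
    have "{z\<in>space ?PZ. (\<lambda>e\<in>E'. x e z) = y} = {z\<in>PiE V A. (\<lambda>e\<in>E'. x e z) = y}"
      by (simp add: PZ)
    then have "measure ?PZ {z\<in>space ?PZ. (\<lambda>e\<in>E'. x e z) = y} = prob {\<omega>\<in>space M. (\<lambda>e\<in>E'. x e (?Z \<omega>)) = y}"
      by (simp only: meas)
    also have "\<dots> = prob {\<omega>\<in>space M. (\<lambda>e\<in>E'. X e \<omega>) = y}"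
    proof (intro finite_measure_eq_AE ev)
      show "{\<omega>\<in>space M. (\<lambda>e\<in>E'. X e \<omega>) = y} \<in> events"
        using simple_functionD(2)[OF XJ[OF E'], of "{y}"] by (simp add: vimage_def Int_def conj_commute)
      show "AE \<omega> in M. (\<omega> \<in> {\<omega>\<in>space M. (\<lambda>e\<in>E'. x e (?Z \<omega>)) = y}) = (\<omega> \<in> {\<omega>\<in>space M. (\<lambda>e\<in>E'. X e \<omega>) = y})"
        using x
      proof eventually_elim
        case (elim \<omega>)
        have "(\<lambda>e\<in>E'. x e (?Z \<omega>)) = (\<lambda>e\<in>E'. X e \<omega>)"
          using elim E' by (intro restrict_ext) auto
        then show ?case by (simp del: restrict_apply)
      qed
    qed
    finally show "measure ?PZ {z\<in>space ?PZ. (\<lambda>e\<in>E'. x e z) = y} = prob {\<omega>\<in>space M. (\<lambda>e\<in>E'. X e \<omega>) = y}" .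
  qed
  ultimately show thesis by (rule that)
qed

section \<open>Finite-valued description of a scheme\<close>

locale edge_scheme = edge_source b V A PZ E \<xi> x k \<mu>
  for b :: real and V :: "nat set" and A :: "nat \<Rightarrow> 'z set" and PZ :: "(nat \<Rightarrow> 'z) measure"
    and E :: "'e set" and \<xi> :: "'e \<Rightarrow> nat set"
    and x :: "'e \<Rightarrow> (nat \<Rightarrow> 'z) \<Rightarrow> 'x" and k :: "nat \<Rightarrow> ('e \<Rightarrow> 'x) \<Rightarrow> 'z" and \<mu> :: "'e \<Rightarrow> 'x \<Rightarrow> real" +
  fixes n :: nat and S :: "'z scheme"
  assumes scheme: "is_scheme V A PZ n S"
begin

abbreviation "N \<equiv> joint_law S"
abbreviation "F \<equiv> discussion n S"

definition ZA :: "nat \<Rightarrow> (nat \<Rightarrow> 'z) set" where "ZA i = (\<Pi>\<^sub>E s\<in>{..<n}. A i)"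
definition ZZ :: "(nat \<Rightarrow> nat \<Rightarrow> 'z) set" where "ZZ = (\<Pi>\<^sub>E s\<in>{..<n}. PiE V A)"
definition obs :: "nat \<Rightarrow> (nat \<Rightarrow> nat \<Rightarrow> 'z) \<Rightarrow> nat \<Rightarrow> 'z" where "obs i z = (\<lambda>s\<in>{..<n}. z s i)"

lemma finite_ZA: "i \<in> V \<Longrightarrow> finite (ZA i)"
  unfolding ZA_def using finite_A by (intro finite_PiE) auto

lemma finite_PiE_VA: "finite (PiE V A)"
  using finite_V finite_A by (intro finite_PiE)

lemma finite_ZZ: "finite ZZ"
  unfolding ZZ_def by (rule finite_PiE[OF finite_lessThan finite_PiE_VA])

lemma Zn_eq: "(\<Pi>\<^sub>M s\<in>{..<n}. \<Pi>\<^sub>M i\<in>V. count_space (A i)) = count_space ZZ"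
proof -
  have "(\<Pi>\<^sub>M s\<in>{..<n}. \<Pi>\<^sub>M i\<in>V. count_space (A i)) = (\<Pi>\<^sub>M s\<in>{..<n}. count_space (PiE V A))"
    by (simp add: PiM_count_space_eq[OF finite_V finite_A])
  also have "\<dots> = count_space ZZ"
    unfolding ZZ_def using finite_PiE_VA by (intro PiM_count_space_eq) auto
  finally show ?thesis .
qed

lemma ZA_eq: "i \<in> V \<Longrightarrow> (\<Pi>\<^sub>M s\<in>{..<n}. count_space (A i)) = count_space (ZA i)"
  unfolding ZA_def using finite_A by (intro PiM_count_space_eq) auto

lemma scheme_props:
  shows prob_rand: "i \<in> V \<Longrightarrow> prob_space (rand_law S i)"
    and sets_rand: "i \<in> V \<Longrightarrow> sets (rand_law S i) = sets borel"
    and finite_keys: "finite (key_alphabet S)"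
    and prob_N: "prob_space N"
    and sets_N: "sets N = sets ((\<Pi>\<^sub>M i\<in>V. borel) \<Otimes>\<^sub>M count_space ZZ \<Otimes>\<^sub>M count_space (key_alphabet S))"
    and law_N: "distr N ((\<Pi>\<^sub>M i\<in>V. borel) \<Otimes>\<^sub>M count_space ZZ) (\<lambda>(u, z, k). (u, z)) =
           (\<Pi>\<^sub>M i\<in>V. rand_law S i) \<Otimes>\<^sub>M (\<Pi>\<^sub>M s\<in>{..<n}. PZ)"
    and speaker: "speaker S t \<in> V"
    and finite_disc: "finite (disc_alphabet S)"
    and disc: "\<omega> \<in> space N \<Longrightarrow> F \<omega> \<in> disc_alphabet S"
    and decoder: "i \<in> V \<Longrightarrow> f \<in> disc_alphabet S \<Longrightarrow>
      decoder S i f \<in> measurable (borel \<Otimes>\<^sub>M count_space (ZA i)) (count_space UNIV)"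
  using scheme by (simp_all add: is_scheme_def Let_def Zn_eq ZA_eq)

lemma message: "message S t h \<in> measurable (borel \<Otimes>\<^sub>M count_space (ZA (speaker S t))) (count_space UNIV)"
  unfolding ZA_eq[OF speaker, symmetric] using scheme by (simp add: is_scheme_def Let_def)

sublocale N: information_space N b
  using prob_N base by (intro information_space.intro information_space_axioms.intro)

lemma space_N: "space N = space (\<Pi>\<^sub>M i\<in>V. borel :: real measure) \<times> ZZ \<times> key_alphabet S"
  using sets_eq_imp_space_eq[OF sets_N] by (simp add: space_pair_measure)

lemma measurable_u: "i \<in> V \<Longrightarrow> (\<lambda>\<omega>. fst \<omega> i) \<in> measurable N borel"
  unfolding measurable_cong_sets[OF sets_N refl]
  by (rule measurable_compose[OF measurable_fst measurable_component_singleton])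

lemma measurable_z: "(\<lambda>\<omega>. fst (snd \<omega>)) \<in> measurable N (count_space ZZ)"
  unfolding measurable_cong_sets[OF sets_N refl]
  by (rule measurable_compose[OF measurable_snd measurable_fst])

lemma simple_z: "simple_function N (\<lambda>\<omega>. fst (snd \<omega>))"
  by (rule simple_function_count_space_finite[OF finite_ZZ measurable_z])

lemma key_eq: "key \<omega> = snd (snd \<omega>)"
  by (simp add: key_def split_beta)

lemma simple_key: "simple_function N key"
proof -
  have "(\<lambda>\<omega>. snd (snd \<omega>)) \<in> measurable N (count_space (key_alphabet S))"
    unfolding measurable_cong_sets[OF sets_N refl]
    by (rule measurable_compose[OF measurable_snd measurable_snd])
  then show ?thesis
    unfolding key_eq[abs_def] by (rule simple_function_count_space_finite[OF finite_keys])
qed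

lemma priv_eq: "priv n i \<omega> = (fst \<omega> i, obs i (fst (snd \<omega>)))"
  by (simp add: priv_def obs_def split_beta)

lemma obs_in_ZA: "\<omega> \<in> space N \<Longrightarrow> i \<in> V \<Longrightarrow> obs i (fst (snd \<omega>)) \<in> ZA i"
proof -
  assume "\<omega> \<in> space N" "i \<in> V"
  then have "fst (snd \<omega>) s i \<in> A i" if "s < n" for s
    using that PiE_mem[of "fst (snd \<omega>)" "{..<n}" "\<lambda>_. PiE V A" s] PiE_mem[of "fst (snd \<omega>) s" V A i]
    by (auto simp: space_N ZZ_def)
  then show ?thesis by (auto simp: ZA_def obs_def)
qed

text \<open>Tests a whole candidate discussion against one user at a time. The discussion that takes
  place is the only sequence that passes the test of every user, which splits it into conditions
  each involving one private variable.\<close>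

definition consistent :: "nat \<Rightarrow> (nat \<Rightarrow> 'z) \<Rightarrow> (nat \<Rightarrow> nat) \<Rightarrow> real \<Rightarrow> bool" where
  "consistent i z f u \<longleftrightarrow> (\<forall>t. speaker S t = i \<longrightarrow> f t = message S t (map f [0..<t]) (u, z))"

text \<open>
  Everything that user \<open>i\<close> can contribute to the discussion or decode from it, with \<open>u\<close> as the only
  argument. It takes finitely many values and inherits the independence of the private randomness,
  so that entropies can be used although \<open>u\<close> is real-valued.
\<close>

definition response :: "nat \<Rightarrow> real \<Rightarrow> ((nat \<Rightarrow> 'z) \<times> (nat \<Rightarrow> nat)) set \<times> ((nat \<Rightarrow> 'z) \<times> (nat \<Rightarrow> nat) \<times> nat) set" where
  "response i u = ({q\<in>ZA i \<times> disc_alphabet S. consistent i (fst q) (snd q) u},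
     {q\<in>ZA i \<times> disc_alphabet S \<times> key_alphabet S. decoder S i (fst (snd q)) (u, fst q) = snd (snd q)})"

text \<open>Each table entry is decided by a Borel event: one value of a decoder, or a countable
  intersection of conditions on single rounds.\<close>

lemma simple_response:
  assumes i: "i \<in> V"
  shows "simple_function borel (response i)"
  unfolding response_def
proof (intro simple_function_Pair simple_function_Collect)
  show "finite (ZA i \<times> disc_alphabet S)" "finite (ZA i \<times> disc_alphabet S \<times> key_alphabet S)"
    using finite_ZA[OF i] finite_disc finite_keys by auto
  have pair: "(\<lambda>u. (u, z)) \<in> measurable borel (borel \<Otimes>\<^sub>M count_space (ZA i))" if "z \<in> ZA i" for z
    using that by (intro measurable_Pair) auto
  have ev: "{u\<in>space borel. g (u, z) = c} \<in> sets borel"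
    if "z \<in> ZA i" "g \<in> measurable (borel \<Otimes>\<^sub>M count_space (ZA i)) (count_space UNIV)" for g z and c :: nat
  proof -
    have "(\<lambda>u. g (u, z)) -` {c} \<inter> space borel \<in> sets borel"
      by (rule measurable_sets[OF measurable_compose[OF pair[OF that(1)] that(2)]]) simp
    then show ?thesis by (simp add: vimage_def)
  qed
  show "{u\<in>space borel. decoder S i (fst (snd q)) (u, fst q) = snd (snd q)} \<in> sets borel"
    if "q \<in> ZA i \<times> disc_alphabet S \<times> key_alphabet S" for q
    using that i by (intro ev decoder) auto
  show "{u\<in>space borel. consistent i (fst q) (snd q) u} \<in> sets borel" if "q \<in> ZA i \<times> disc_alphabet S" for q
    unfolding consistent_def
  proof (intro sets.sets_Collect_countable_All)
    fix t
    show "{u\<in>space borel. speaker S t = i \<longrightarrow> snd q t = message S t (map (snd q) [0..<t]) (u, fst q)} \<in> sets borel"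
    proof (cases "speaker S t = i")
      case True
      have eq: "{u\<in>space borel. speaker S t = i \<longrightarrow> snd q t = message S t (map (snd q) [0..<t]) (u, fst q)} =
        {u\<in>space borel. message S t (map (snd q) [0..<t]) (u, fst q) = snd q t}"
        using True by auto
      show ?thesis
        unfolding eq using that message[of t "map (snd q) [0..<t]"] True by (intro ev) auto
    next
      case False
      then have eq: "{u\<in>space borel. speaker S t = i \<longrightarrow> snd q t = message S t (map (snd q) [0..<t]) (u, fst q)} = space borel"
        by auto
      show ?thesis unfolding eq by (rule sets.top)
    qed
  qed
qed

lemma simple_response_u: "i \<in> V \<Longrightarrow> simple_function N (\<lambda>\<omega>. response i (fst \<omega> i))"
  by (rule simple_function_comp[OF measurable_u simple_response])

lemma history_eq: "history n S t \<omega> = map (F \<omega>) [0..<t]"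
proof (induction t)
  case (Suc t)
  have "history n S (Suc t) \<omega> = history n S t \<omega> @ [F \<omega> t]"
    by (simp only: history.simps discussion_def)
  then show ?case by (simp add: Suc.IH del: history.simps)
qed simp

lemma consistent_discussion: "consistent i (obs i (fst (snd \<omega>))) (F \<omega>) (fst \<omega> i)"
  unfolding consistent_def
proof (intro allI impI)
  fix t assume "speaker S t = i"
  then have "F \<omega> t = message S t (history n S t \<omega>) (priv n i \<omega>)"
    by (simp only: discussion_def)
  then show "F \<omega> t = message S t (map (F \<omega>) [0..<t]) (fst \<omega> i, obs i (fst (snd \<omega>)))"
    by (simp only: history_eq priv_eq)
qed

text \<open>Strong induction on the rounds: entry t is forced by the earlier entries through the
  test of the speaker of round t.\<close>

lemma discussion_unique:
  assumes "\<And>i. i \<in> V \<Longrightarrow> consistent i (obs i (fst (snd \<omega>))) f (fst \<omega> i)"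
  shows "f = F \<omega>"
proof
  fix t
  show "f t = F \<omega> t"
  proof (induction t rule: less_induct)
    case (less t)
    then have "map f [0..<t] = map (F \<omega>) [0..<t]" by simp
    then show ?case
      using assms[OF speaker[of t]]
      by (simp add: consistent_def discussion_def history_eq priv_eq del: map_eq_conv)
  qed
qed

text \<open>The discussion is recovered from finitely-valued data, the tables and the source
  symbols, by a search in the discussion alphabet: it passes every test, and
  \<open>discussion_unique\<close> rules out anything else.\<close>

lemma simple_discussion: "simple_function N F"
proof -
  define g where "g w = (SOME f. f \<in> disc_alphabet S \<and> (\<forall>i\<in>V. (obs i (snd w), f) \<in> fst (fst w i)))"
    for w :: "(nat \<Rightarrow> ((nat \<Rightarrow> 'z) \<times> (nat \<Rightarrow> nat)) set \<times> ((nat \<Rightarrow> 'z) \<times> (nat \<Rightarrow> nat) \<times> nat) set) \<times> (nat \<Rightarrow> nat \<Rightarrow> 'z)"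
  have "F \<omega> = g (\<lambda>i\<in>V. response i (fst \<omega> i), fst (snd \<omega>))" if \<omega>: "\<omega> \<in> space N" for \<omega>
  proof -
    let ?Q = "\<lambda>f. f \<in> disc_alphabet S \<and> (\<forall>i\<in>V. (obs i (fst (snd \<omega>)), f) \<in> fst ((\<lambda>i\<in>V. response i (fst \<omega> i)) i))"
    have "?Q (F \<omega>)"
      using disc[OF \<omega>] obs_in_ZA[OF \<omega>] consistent_discussion by (auto simp: response_def)
    then have "?Q (g (\<lambda>i\<in>V. response i (fst \<omega> i), fst (snd \<omega>)))"
      unfolding g_def fst_conv snd_conv by (rule someI[of ?Q])
    then have "g (\<lambda>i\<in>V. response i (fst \<omega> i), fst (snd \<omega>)) = F \<omega>"
      by (intro discussion_unique) (auto simp: response_def)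
    then show ?thesis by simp
  qed
  moreover have "simple_function N (\<lambda>\<omega>. g (\<lambda>i\<in>V. response i (fst \<omega> i), fst (snd \<omega>)))"
    by (intro simple_function_compose1[of N _ g] simple_function_Pair N.simple_function_restrict
      finite_V simple_response_u simple_z)
  ultimately show ?thesis by (subst simple_function_cong)
qed

lemma simple_history: "simple_function N (history n S t)"
  unfolding history_eq[abs_def] by (rule simple_function_compose1[OF simple_discussion])

text \<open>The independent family to which the covering bound is applied: \<open>Inl i\<close> is
  the table of user i, \<open>Inr (e, s)\<close> the value of edge e in the s-th symbol. The sum
  type on the values lets both kinds form one family.\<close>

definition Y :: "nat + 'e \<times> nat \<Rightarrow> (nat \<Rightarrow> real) \<times> (nat \<Rightarrow> nat \<Rightarrow> 'z) \<times> nat \<Rightarrow>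
  (((nat \<Rightarrow> 'z) \<times> (nat \<Rightarrow> nat)) set \<times> ((nat \<Rightarrow> 'z) \<times> (nat \<Rightarrow> nat) \<times> nat) set) + 'x" where
  "Y j \<omega> = (case j of Inl i \<Rightarrow> Inl (response i (fst \<omega> i)) | Inr (e, s) \<Rightarrow> Inr (x e (fst (snd \<omega>) s)))"

lemma Y_simps [simp]:
  "Y (Inl i) \<omega> = Inl (response i (fst \<omega> i))"
  "Y (Inr (e, s)) \<omega> = Inr (x e (fst (snd \<omega>) s))"
  by (simp_all add: Y_def)

lemma simple_Y: "j \<in> V <+> E \<times> {..<n} \<Longrightarrow> simple_function N (Y j)"
proof (elim PlusE; clarify)
  show "simple_function N (Y (Inl i))" if "i \<in> V" for i
    unfolding Y_simps[abs_def] by (rule simple_function_compose1[OF simple_response_u[OF that]])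
  show "simple_function N (Y (Inr (e, s)))" for e s
    unfolding Y_simps[abs_def] by (rule simple_function_compose1[OF simple_z])
qed

text \<open>The independence of private randomness and source symbols enters through this formula.
  The key is integrated out, since its dependence on the rest is arbitrary.\<close>

lemma measure_rect:
  assumes U: "\<And>i. i \<in> V \<Longrightarrow> Us i \<in> sets borel" and T: "\<And>s. s < n \<Longrightarrow> Ts s \<subseteq> PiE V A"
  shows "N.prob {\<omega>\<in>space N. (\<forall>i\<in>V. fst \<omega> i \<in> Us i) \<and> (\<forall>s<n. fst (snd \<omega>) s \<in> Ts s)} =
    (\<Prod>i\<in>V. measure (rand_law S i) (Us i)) * (\<Prod>s<n. measure PZ (Ts s))"
proof -
  let ?U = "\<Pi>\<^sub>M i\<in>V. borel :: real measure" and ?f = "\<lambda>\<omega>. (fst \<omega>, fst (snd \<omega>))"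
  \<comment> \<open>The product space rules ask for a probability measure at every index, so a point
    mass fills in outside \<open>V\<close>.\<close>
  let ?R = "\<lambda>i. if i \<in> V then rand_law S i else return borel 0"
  let ?W = "PiE V Us \<times> PiE {..<n} Ts"
  have f: "(\<lambda>(u, z, k). (u, z)) = ?f" by auto
  interpret PZ: prob_space PZ by (rule prob_PZ)
  have probR: "prob_space (?R i)" for i
    using prob_rand[of i] prob_space_return[of "0::real" borel] by simp
  interpret R': product_prob_space ?R V by (rule product_prob_spaceI[OF probR])
  interpret R: finite_product_prob_space ?R V by standard (rule finite_V)
  interpret P': product_prob_space "\<lambda>_. PZ" "{..<n}" by (rule product_prob_spaceI[OF prob_PZ])
  interpret P: finite_product_prob_space "\<lambda>_. PZ" "{..<n}" by standard simp
  have R: "PiM V (rand_law S) = PiM V ?R" by (intro PiM_cong) auto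
  have m: "?f \<in> measurable N (?U \<Otimes>\<^sub>M count_space ZZ)"
    unfolding measurable_cong_sets[OF sets_N refl]
    by (intro measurable_Pair measurable_fst measurable_compose[OF measurable_snd measurable_fst])
  have WU: "PiE V Us \<in> sets ?U"
    using U finite_V by (intro sets_PiM_I_finite) auto
  have WZ: "PiE {..<n} Ts \<subseteq> ZZ" using T by (auto simp: ZZ_def PiE_iff)
  have "{\<omega>\<in>space N. (\<forall>i\<in>V. fst \<omega> i \<in> Us i) \<and> (\<forall>s<n. fst (snd \<omega>) s \<in> Ts s)} = ?f -` ?W \<inter> space N"
    by (auto simp: space_N space_PiM PiE_iff ZZ_def)
  also have "N.prob \<dots> = measure (distr N (?U \<Otimes>\<^sub>M count_space ZZ) ?f) ?W"
    using WU WZ by (intro measure_distr[OF m, symmetric]) auto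
  also have "\<dots> = measure (PiM V ?R \<Otimes>\<^sub>M (\<Pi>\<^sub>M s\<in>{..<n}. PZ)) ?W"
    using law_N unfolding f R by simp
  also have "\<dots> = measure (PiM V ?R) (PiE V Us) * measure (\<Pi>\<^sub>M s\<in>{..<n}. PZ) (PiE {..<n} Ts)"
  proof -
    have "PiE V Us \<in> sets (PiM V ?R)"
      using U finite_V sets_rand by (intro sets_PiM_I_finite) auto
    moreover have "PiE {..<n} Ts \<in> sets (\<Pi>\<^sub>M s\<in>{..<n}. PZ)"
      using T sets_PZ by (intro sets_PiM_I_finite) auto
    moreover have "sigma_finite_measure (\<Pi>\<^sub>M s\<in>{..<n}. PZ)"
      by (intro prob_space_imp_sigma_finite prob_space_PiM prob_PZ)
    ultimately show ?thesis
      by (simp add: measure_def sigma_finite_measure.emeasure_pair_measure_Times enn2real_mult)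
  qed
  also have "measure (PiM V ?R) (PiE V Us) = (\<Prod>i\<in>V. measure (?R i) (Us i))"
    using U sets_rand by (intro R.prob_times) auto
  also have "\<dots> = (\<Prod>i\<in>V. measure (rand_law S i) (Us i))"
    by (intro prod.cong) auto
  also have "measure (\<Pi>\<^sub>M s\<in>{..<n}. PZ) (PiE {..<n} Ts) = (\<Prod>s<n. measure PZ (Ts s))"
    using T sets_PZ by (intro P.prob_times) auto
  finally show ?thesis .
qed

lemma component_in: "\<omega> \<in> space N \<Longrightarrow> s < n \<Longrightarrow> fst (snd \<omega>) s \<in> PiE V A"
  using PiE_mem[of "fst (snd \<omega>)" "{..<n}" "\<lambda>_. PiE V A" s] by (auto simp: space_N ZZ_def)

lemma space_PZ: "space PZ = PiE V A"
  using sets_eq_imp_space_eq[of PZ "count_space (PiE V A)"] sets_PZ by simp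

text \<open>Prescribing all values of the family defines a rectangle: the table of user i restricts
  only the i-th private variable, and the edge values restrict one symbol each.
  \<open>edge_law\<close> then splits the factor of each symbol over the edges.\<close>

lemma Y_independent:
  "(\<Sum>j\<in>V <+> E \<times> {..<n}. ent b N (Y j)) \<le> ent b N (\<lambda>\<omega>. \<lambda>j\<in>V <+> E \<times> {..<n}. Y j \<omega>)"
proof -
  let ?J = "V <+> E \<times> {..<n}"
  define q where "q j y = (case j of Inl i \<Rightarrow> measure (rand_law S i) {u. Inl (response i u) = y}
     | Inr (e, s) \<Rightarrow> \<mu> e (projr y))" for j :: "nat + 'e \<times> nat" and y :: "_ + 'x"
  show ?thesis
  proof (rule N.entropy_restrict_ge_sum[where q=q])
    show "finite ?J" using finite_V finite_E by simp
    show "simple_function N (Y j)" if "j \<in> ?J" for j by (rule simple_Y[OF that])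
    show "0 \<le> q j y" if "j \<in> ?J" for j y using that \<mu>_nonneg by (auto simp: q_def)
    show "(\<Sum>y\<in>Y j ` space N. q j y) \<le> 1" if j: "j \<in> ?J" for j
      using j
    proof (elim PlusE; clarify)
      fix i assume i: "i \<in> V"
      interpret R: prob_space "rand_law S i" by (rule prob_rand[OF i])
      have sp: "space (rand_law S i) = UNIV" using sets_eq_imp_space_eq[OF sets_rand[OF i]] by simp
      have "simple_function (rand_law S i) (\<lambda>u. Inl (response i u) :: _ + 'x)"
        using simple_function_compose1[OF simple_response[OF i], of "Inl :: _ \<Rightarrow> _ + 'x"] sets_rand[OF i]
        by (simp add: simple_function_def sp)
      then have "(\<Sum>y\<in>Y (Inl i) ` space N. R.prob {u\<in>space (rand_law S i). Inl (response i u) = y}) \<le> 1"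
        using simple_functionD(1)[OF simple_Y[of "Inl i"]] i by (intro R.sum_prob_eq_le_1) auto
      then show "(\<Sum>y\<in>Y (Inl i) ` space N. q (Inl i) y) \<le> 1" by (simp add: q_def sp)
    next
      fix e s assume es: "e \<in> E" "s < n"
      let ?x = "\<lambda>\<omega>. x e (fst (snd \<omega>) s)"
      have "(\<Sum>y\<in>Y (Inr (e, s)) ` space N. q (Inr (e, s)) y) = (\<Sum>v\<in>?x ` space N. \<mu> e v)"
        unfolding Y_simps[abs_def] image_image[of Inr ?x, symmetric] by (simp add: sum.reindex q_def)
      also have "\<dots> \<le> 1"
        by (intro \<mu>_le_1 es simple_functionD(1)[OF simple_function_compose1[OF simple_z, of "\<lambda>z. x e (z s)"]])
      finally show "(\<Sum>y\<in>Y (Inr (e, s)) ` space N. q (Inr (e, s)) y) \<le> 1" .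
    qed
    fix y assume y: "y \<in> (\<Pi>\<^sub>E j\<in>?J. Y j ` space N)"
    let ?Us = "\<lambda>i. {u. Inl (response i u) = y (Inl i)}"
    let ?Ts = "\<lambda>s. {z\<in>PiE V A. \<forall>e\<in>E. x e z = projr (y (Inr (e, s)))}"
    \<comment> \<open>The prescribed value lies in the range of \<open>Y\<close>, so it has the form
      \<open>Inr\<close> and \<open>projr\<close> loses nothing.\<close>
    have yr: "Y (Inr (e, s)) \<omega> = y (Inr (e, s)) \<longleftrightarrow> x e (fst (snd \<omega>) s) = projr (y (Inr (e, s)))"
      if "e \<in> E" "s < n" for e s \<omega>
    proof -
      have "y (Inr (e, s)) \<in> Y (Inr (e, s)) ` space N"
        using that by (intro PiE_mem[OF y]) auto
      then show ?thesis by auto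
    qed
    have "{\<omega>\<in>space N. \<forall>j\<in>?J. Y j \<omega> = y j} =
       {\<omega>\<in>space N. (\<forall>i\<in>V. Y (Inl i) \<omega> = y (Inl i)) \<and> (\<forall>s<n. \<forall>e\<in>E. Y (Inr (e, s)) \<omega> = y (Inr (e, s)))}"
      by blast
    also have "\<dots> = {\<omega>\<in>space N. (\<forall>i\<in>V. fst \<omega> i \<in> ?Us i) \<and> (\<forall>s<n. fst (snd \<omega>) s \<in> ?Ts s)}"
      by (intro Collect_cong conj_cong refl ball_cong all_cong)
        (auto simp: yr component_in simp del: Y_simps(2))
    also have "N.prob \<dots> = (\<Prod>i\<in>V. measure (rand_law S i) (?Us i)) * (\<Prod>s<n. measure PZ (?Ts s))"
    proof (rule measure_rect)
      fix i assume i: "i \<in> V"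
      have "(\<lambda>u. Inl (response i u) :: _ + 'x) -` {y (Inl i)} \<inter> space borel \<in> sets borel"
        by (rule simple_functionD(2)[OF simple_function_compose1[OF simple_response[OF i]]])
      then show "?Us i \<in> sets borel" by (simp add: vimage_def)
    qed auto
    also have "(\<Prod>s<n. measure PZ (?Ts s)) = (\<Prod>s<n. \<Prod>e\<in>E. q (Inr (e, s)) (y (Inr (e, s))))"
      by (simp add: edge_law q_def)
    also have "\<dots> = (\<Prod>es\<in>E \<times> {..<n}. q (Inr es) (y (Inr es)))"
      by (subst prod.swap) (simp add: prod.cartesian_product split_beta)
    also have "(\<Prod>i\<in>V. measure (rand_law S i) (?Us i)) = (\<Prod>i\<in>V. q (Inl i) (y (Inl i)))"
      by (simp add: q_def)
    finally show "N.prob {\<omega>\<in>space N. \<forall>j\<in>?J. Y j \<omega> = y j} = (\<Prod>j\<in>?J. q j (y j))"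
      using finite_V finite_E by (simp add: prod.Plus)
  qed
qed

text \<open>A rectangle whose other sides are all full.\<close>

lemma component_law:
  assumes s: "s < n" and T: "T \<subseteq> PiE V A"
  shows "N.prob {\<omega>\<in>space N. fst (snd \<omega>) s \<in> T} = measure PZ T"
proof -
  interpret PZ: prob_space PZ by (rule prob_PZ)
  let ?Ts = "\<lambda>s'. if s' = s then T else PiE V A"
  have eq: "{\<omega>\<in>space N. fst (snd \<omega>) s \<in> T} =
      {\<omega>\<in>space N. (\<forall>i\<in>V. fst \<omega> i \<in> UNIV) \<and> (\<forall>s<n. fst (snd \<omega>) s \<in> ?Ts s)}"
  proof (intro Collect_cong conj_cong refl iffI conjI ballI allI impI)
    fix \<omega> s' assume "\<omega> \<in> space N" "fst (snd \<omega>) s \<in> T" "s' < n"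
    then show "fst (snd \<omega>) s' \<in> ?Ts s'" using component_in by simp
  qed (use s in \<open>auto split: if_splits\<close>)
  have "N.prob {\<omega>\<in>space N. fst (snd \<omega>) s \<in> T} = (\<Prod>i\<in>V. measure (rand_law S i) UNIV) * (\<Prod>s<n. measure PZ (?Ts s))"
    unfolding eq using T by (intro measure_rect) auto
  also have "(\<Prod>i\<in>V. measure (rand_law S i) UNIV) = 1"
  proof (rule prod.neutral, rule ballI)
    fix i assume i: "i \<in> V"
    show "measure (rand_law S i) UNIV = 1"
      using prob_space.prob_space[OF prob_rand[OF i]] sets_eq_imp_space_eq[OF sets_rand[OF i]] by simp
  qed
  also have "(\<Prod>s<n. measure PZ (?Ts s)) = (\<Prod>s'<n. if s' = s then measure PZ T else 1)"
    using PZ.prob_space unfolding space_PZ by (intro prod.cong) auto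
  also have "\<dots> = measure PZ T" using s by simp
  finally show ?thesis by simp
qed

text \<open>Carries the reconstruction of observations from edge variables over from
  \<open>PZ\<close> to all n symbols, at the cost of n null sets. Through it the edge variables of a
  block determine what its users observe.\<close>

lemma AE_obs:
  "AE \<omega> in N. \<forall>i\<in>V. obs i (fst (snd \<omega>)) = (\<lambda>s\<in>{..<n}. k i (\<lambda>e\<in>{e\<in>E. i \<in> \<xi> e}. x e (fst (snd \<omega>) s)))"
proof -
  let ?Q = "\<lambda>z. \<forall>i\<in>V. z i = k i (\<lambda>e\<in>{e\<in>E. i \<in> \<xi> e}. x e z)"
  interpret PZ: prob_space PZ by (rule prob_PZ)
  have "AE \<omega> in N. \<forall>s\<in>{..<n}. ?Q (fst (snd \<omega>) s)"
  proof (rule AE_finite_allI)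
    fix s assume "s \<in> {..<n}" then have s: "s < n" by simp
    have ev: "{\<omega>\<in>space N. fst (snd \<omega>) s \<in> T} \<in> N.events" for T
    proof -
      have "(\<lambda>\<omega>. fst (snd \<omega>)) -` {z. z s \<in> T} \<inter> space N \<in> N.events"
        by (rule simple_functionD(2)[OF simple_z])
      then show ?thesis by (simp add: vimage_def Int_def conj_commute)
    qed
    have "measure PZ {z\<in>PiE V A. \<not> ?Q z} = 0"
      using edges sets_PZ by (subst PZ.prob_eq_0) auto
    then have "N.prob {\<omega>\<in>space N. fst (snd \<omega>) s \<in> {z\<in>PiE V A. \<not> ?Q z}} = 0"
      using component_law[OF s, of "{z\<in>PiE V A. \<not> ?Q z}"] by simp
    then have "AE \<omega> in N. \<omega> \<notin> {\<omega>\<in>space N. fst (snd \<omega>) s \<in> {z\<in>PiE V A. \<not> ?Q z}}"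
      by (rule N.prob_eq_0[OF ev, THEN iffD1])
    then show "AE \<omega> in N. ?Q (fst (snd \<omega>) s)"
      using AE_space
    proof eventually_elim
      case (elim \<omega>)
      then show ?case using component_in[OF elim(2) s] by blast
    qed
  qed simp
  then show ?thesis
    by eventually_elim (auto simp: obs_def)
qed

text \<open>Subadditivity over the n symbols, each of which has law \<open>PZ\<close>. An upper
  bound is the right direction because the common part is subtracted from the key entropy.\<close>

lemma common_entropy_le:
  "ent b N (\<lambda>\<omega>. \<lambda>j\<in>Inr ` (E0 \<times> {..<n}). Y j \<omega>) \<le> real n * ent b PZ (\<lambda>z. \<lambda>e\<in>E0. x e z)"
  if E0: "E0 \<subseteq> E"
proof -
  let ?X = "\<lambda>s \<omega>. \<lambda>e\<in>E0. x e (fst (snd \<omega>) s)"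
  have sX: "simple_function N (?X s)" for s
    by (rule simple_function_compose1[OF simple_z, of "\<lambda>z. \<lambda>e\<in>E0. x e (z s)"])
  have fE0: "finite E0" using E0 finite_E finite_subset by auto
  have "ent b N (\<lambda>\<omega>. \<lambda>j\<in>Inr ` (E0 \<times> {..<n}). Y j \<omega>) \<le> ent b N (\<lambda>\<omega>. \<lambda>s\<in>{..<n}. ?X s \<omega>)"
    by (rule N.entropy_mono[where f="\<lambda>w. \<lambda>j\<in>Inr ` (E0 \<times> {..<n}). case j of Inr (e, s) \<Rightarrow> Inr (w s e)"])
       (use E0 in \<open>auto intro!: N.simple_function_restrict fE0 sX simple_Y simp del: restrict_apply Y_simps,
         auto simp: fun_eq_iff\<close>)
  also have "\<dots> \<le> (\<Sum>s\<in>{..<n}. ent b N (?X s))"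
    by (intro N.entropy_restrict_le_sum sX) simp
  also have "\<dots> = (\<Sum>s\<in>{..<n}. ent b PZ (\<lambda>z. \<lambda>e\<in>E0. x e z))"
  proof (intro sum.cong refl entropy_eq_of_law)
    fix s y assume "s \<in> {..<n}" then have s: "s < n" by simp
    show "information_space N b" by unfold_locales
    show "information_space PZ b"
      using prob_PZ base by (intro information_space.intro information_space_axioms.intro)
    show "simple_function N (?X s)" by (rule sX)
    show "simple_function PZ (\<lambda>z. \<lambda>e\<in>E0. x e z)"
      using finite_PiE_VA by (auto simp: simple_function_def space_PZ sets_PZ)
    have "{\<omega>\<in>space N. ?X s \<omega> = y} = {\<omega>\<in>space N. fst (snd \<omega>) s \<in> {z\<in>PiE V A. (\<lambda>e\<in>E0. x e z) = y}}"
      using component_in[OF _ s] by blast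
    also have "N.prob \<dots> = measure PZ {z\<in>PiE V A. (\<lambda>e\<in>E0. x e z) = y}"
      by (rule component_law[OF s]) auto
    finally show "N.prob {\<omega>\<in>space N. ?X s \<omega> = y} = measure PZ {z\<in>space PZ. (\<lambda>e\<in>E0. x e z) = y}"
      by (simp only: space_PZ)
  qed
  finally show ?thesis by simp
qed

end

text \<open>Supplies a number of rounds after which the history determines the infinite discussion,
  so the estimate for finitely many rounds applies to all of it.\<close>

lemma finite_sequences_separated:
  fixes D :: "(nat \<Rightarrow> 'a) set"
  assumes "finite D"
  shows "\<exists>t. inj_on (\<lambda>f. map f [0..<t]) D"
proof -
  define dif where "dif = (\<lambda>(f, g). SOME t :: nat. f t \<noteq> (g t :: 'a))"
  \<comment> \<open>\<open>Suc\<close> puts the last separating position inside the prefix;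
    \<open>insert 0\<close> covers an empty \<open>D\<close>.\<close>
  define t where "t = Suc (Max (insert 0 (dif ` (D \<times> D))))"
  have "inj_on (\<lambda>f. map f [0..<t]) D"
  proof (rule inj_onI, rule ccontr)
    fix f g assume fg: "f \<in> D" "g \<in> D" and eq: "map f [0..<t] = map g [0..<t]" and ne: "f \<noteq> g"
    have "dif (f, g) \<le> Max (insert 0 (dif ` (D \<times> D)))"
      using assms fg by (intro Max_ge) auto
    then have "dif (f, g) < t" by (simp add: t_def)
    then have "f (dif (f, g)) = g (dif (f, g))" using eq by (simp add: map_eq_conv)
    moreover have "f (dif (f, g)) \<noteq> g (dif (f, g))"
      using ne someI_ex[of "\<lambda>t. f t \<noteq> g t"] by (auto simp: dif_def)
    ultimately show False by simp
  qed
  then show ?thesis ..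
qed

section \<open>Discussion and decoding from the variables of a block\<close>

context edge_scheme
begin

text \<open>The edge variables give the speaker's observation. Any discussion in the speaker's table
  that extends the present history has the true message in round t, because consistency fixes what
  the speaker says after this history; it may differ from the actual discussion later on.\<close>

lemma step_from_block:
  fixes B :: "(nat + 'e \<times> nat) set"
  assumes B: "Inl (speaker S t) \<in> B" "\<And>e s. e \<in> E \<Longrightarrow> speaker S t \<in> \<xi> e \<Longrightarrow> s < n \<Longrightarrow> Inr (e, s) \<in> B"
  shows "AE \<omega> in N. history n S (Suc t) \<omega> = (\<lambda>h w. h @ [(SOME f. ((\<lambda>s\<in>{..<n}. k (speaker S t)
      (\<lambda>e\<in>{e\<in>E. speaker S t \<in> \<xi> e}. projr (w (Inr (e, s))))), f) \<in> fst (projl (w (Inl (speaker S t)))) \<and>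
      map f [0..<t] = h) t]) (history n S t \<omega>) (\<lambda>j\<in>B. Y j \<omega>)"
  using AE_obs AE_space
proof eventually_elim
  case (elim \<omega>)
  let ?i = "speaker S t" and ?w = "\<lambda>j\<in>B. Y j \<omega>" and ?h = "history n S t \<omega>"
  let ?z = "\<lambda>s\<in>{..<n}. k ?i (\<lambda>e\<in>{e\<in>E. ?i \<in> \<xi> e}. projr (?w (Inr (e, s))))"
  have "?z = (\<lambda>s\<in>{..<n}. k ?i (\<lambda>e\<in>{e\<in>E. ?i \<in> \<xi> e}. x e (fst (snd \<omega>) s)))"
    using B by (intro restrict_ext arg_cong[where f="k ?i"]) auto
  then have z: "?z = obs ?i (fst (snd \<omega>))" using elim(1) speaker by simp
  let ?Q = "\<lambda>f. (?z, f) \<in> fst (projl (?w (Inl ?i))) \<and> map f [0..<t] = ?h"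
  \<comment> \<open>The actual discussion shows that the choice is not void.\<close>
  have "?Q (F \<omega>)"
    unfolding z using B(1) disc[OF elim(2)] obs_in_ZA[OF elim(2) speaker] consistent_discussion
    by (simp add: response_def history_eq)
  then have Q: "?Q (Eps ?Q)" by (rule someI[of ?Q])
  define f where "f = Eps ?Q"
  note Q = Q[folded f_def]
  then have "consistent ?i (obs ?i (fst (snd \<omega>))) f (fst \<omega> ?i)"
    unfolding z using B(1) by (simp add: response_def)
  then have "f t = message S t (map f [0..<t]) (fst \<omega> ?i, obs ?i (fst (snd \<omega>)))"
    unfolding consistent_def by blast
  also have "\<dots> = message S t ?h (priv n ?i \<omega>)"
    using Q by (simp only: priv_eq)
  finally show ?case by (simp add: f_def)
qed

lemma response_decodes:
  assumes "\<omega> \<in> space N" "i \<in> V"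
  shows "(obs i (fst (snd \<omega>)), F \<omega>, c) \<in> snd (response i (fst \<omega> i)) \<longleftrightarrow>
    c \<in> key_alphabet S \<and> decoder S i (F \<omega>) (priv n i \<omega>) = c"
  using disc[OF assms(1)] obs_in_ZA[OF assms] by (simp add: response_def priv_eq)

text \<open>A single user of the block suffices: its observation comes from the edges, the
  discussion from inverting the prefix map, and the decoded key from the second component of its
  table. If no user errs, this lookup returns the key almost surely.\<close>

lemma decode_from_block:
  fixes B :: "(nat + 'e \<times> nat) set"
  assumes i: "i \<in> V" and B: "Inl i \<in> B" "\<And>e s. e \<in> E \<Longrightarrow> i \<in> \<xi> e \<Longrightarrow> s < n \<Longrightarrow> Inr (e, s) \<in> B"
    and t: "inj_on (\<lambda>f. map f [0..<t]) (disc_alphabet S)"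
  shows "\<exists>g. N.prob {\<omega>\<in>space N. key \<omega> \<noteq> g (history n S t \<omega>, \<lambda>j\<in>B. Y j \<omega>)} \<le> error_prob V n S"
proof -
  let ?z = "\<lambda>w. \<lambda>s\<in>{..<n}. k i (\<lambda>e\<in>{e\<in>E. i \<in> \<xi> e}. projr (w (Inr (e, s))))"
  let ?f = "\<lambda>h. the_inv_into (disc_alphabet S) (\<lambda>f. map f [0..<t]) h"
  define g where "g hw = (case hw of (h, w) \<Rightarrow> SOME c. (?z w, ?f h, c) \<in> snd (projl (w (Inl i))))"
    for hw :: "nat list \<times> (nat + 'e \<times> nat \<Rightarrow> (((nat \<Rightarrow> 'z) \<times> (nat \<Rightarrow> nat)) set \<times> ((nat \<Rightarrow> 'z) \<times> (nat \<Rightarrow> nat) \<times> nat) set) + 'x)"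
  let ?err = "{\<omega>\<in>space N. \<exists>i\<in>V. key \<omega> \<noteq> decoder S i (F \<omega>) (priv n i \<omega>)}"
  have f: "?f (history n S t \<omega>) = F \<omega>" if "\<omega> \<in> space N" for \<omega>
    unfolding history_eq by (rule the_inv_into_f_f[OF t disc[OF that]])
  have key_in: "key \<omega> \<in> key_alphabet S" if "\<omega> \<in> space N" for \<omega>
    using that by (auto simp: space_N key_eq)
  \<comment> \<open>Expressed through the tables, the error event depends on finitely-valued
    variables only; monotonicity of the measure asks for it to be an event.\<close>
  have err: "?err \<in> N.events"
  proof -
    let ?R = "\<lambda>\<omega>. (\<lambda>i\<in>V. response i (fst \<omega> i), fst (snd \<omega>), F \<omega>, key \<omega>)"
    have sf: "simple_function N ?R"
      by (intro simple_function_Pair N.simple_function_restrict finite_V simple_response_u simple_z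
        simple_discussion simple_key)
    have "?err = {\<omega>\<in>space N. \<exists>i\<in>V. (obs i (fst (snd \<omega>)), F \<omega>, key \<omega>) \<notin> snd (response i (fst \<omega> i))}"
      by (intro Collect_cong conj_cong bex_cong refl) (simp add: response_decodes key_in eq_commute)
    also have "\<dots> = ?R -` {(r, z, f, c). \<exists>i\<in>V. (obs i z, f, c) \<notin> snd (r i)} \<inter> space N"
      by auto
    finally have eq: "?err = ?R -` {(r, z, f, c). \<exists>i\<in>V. (obs i z, f, c) \<notin> snd (r i)} \<inter> space N" .
    show ?thesis unfolding eq by (rule simple_functionD(2)[OF sf])
  qed
  have "AE \<omega> in N. \<omega> \<in> {\<omega>\<in>space N. key \<omega> \<noteq> g (history n S t \<omega>, \<lambda>j\<in>B. Y j \<omega>)} \<longrightarrow> \<omega> \<in> ?err"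
    using AE_obs AE_space
  proof eventually_elim
    case (elim \<omega>)
    let ?w = "\<lambda>j\<in>B. Y j \<omega>"
    have "?z ?w = (\<lambda>s\<in>{..<n}. k i (\<lambda>e\<in>{e\<in>E. i \<in> \<xi> e}. x e (fst (snd \<omega>) s)))"
      using B by (intro restrict_ext arg_cong[where f="k i"]) auto
    then have z: "?z ?w = obs i (fst (snd \<omega>))" using elim(1) i by simp
    show ?case
    proof (intro impI, rule ccontr)
      assume 1: "\<omega> \<in> {\<omega>\<in>space N. key \<omega> \<noteq> g (history n S t \<omega>, \<lambda>j\<in>B. Y j \<omega>)}" and "\<omega> \<notin> ?err"
      then have dec: "decoder S i (F \<omega>) (priv n i \<omega>) = key \<omega>"
        using i elim(2) by auto
      \<comment> \<open>The key belongs to its alphabet, so the table holds exactly one entry for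
        this observation and discussion.\<close>
      have "((?z ?w, ?f (history n S t \<omega>), c) \<in> snd (projl (?w (Inl i)))) \<longleftrightarrow> c = key \<omega>" for c
        unfolding z f[OF elim(2)]
        by (simp add: response_decodes[OF elim(2) i] dec B(1)) (use key_in[OF elim(2)] in blast)
      then have "g (history n S t \<omega>, ?w) = key \<omega>"
        by (simp add: g_def)
      with 1 show False by simp
    qed
  qed
  from N.finite_measure_mono_AE[OF this err] show ?thesis
    unfolding error_prob_def by blast
qed

lemma scheme_bound:
  fixes P :: "nat set set" and p :: nat
  assumes P: "partition_on V P" and p: "1 \<le> p" "p \<le> card P"
    and cover: "\<And>e. e \<in> E \<Longrightarrow> \<xi> e \<noteq> V \<Longrightarrow> card {C\<in>P. C \<inter> \<xi> e \<noteq> {}} \<le> p"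
  shows "(real (card P) - real p) *
      (cond_ent b N key F - real n * ent b PZ (\<lambda>z. \<lambda>e\<in>{e\<in>E. \<xi> e = V}. x e z))
    \<le> (real p - 1) * log b (real (card (disc_alphabet S))) +
      real (card P) * (log b 2 + error_prob V n S * log b (real (card (key_alphabet S))))"
proof -
  have fP: "finite P" using finite_V P by (rule finite_elements)
  let ?E0 = "{e\<in>E. \<xi> e = V}"
  have E0: "?E0 \<subseteq> E" by auto
  \<comment> \<open>A block sees the tables of its users and all n copies of each edge that meets
    it. \<open>?J0\<close> collects the copies of the edges equal to \<open>V\<close>, which every
    block sees.\<close>
  let ?J0 = "Inr ` (?E0 \<times> {..<n}) :: (nat + 'e \<times> nat) set"
  let ?B = "\<lambda>C. C <+> {e\<in>E. C \<inter> \<xi> e \<noteq> {}} \<times> {..<n} :: (nat + 'e \<times> nat) set"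
  let ?\<epsilon> = "log b 2 + error_prob V n S * log b (real (card (key_alphabet S)))"
  obtain t where t: "inj_on (\<lambda>f. map f [0..<t]) (disc_alphabet S)"
    using finite_sequences_separated[OF finite_disc] by blast
  have blocks: "C \<noteq> {}" "C \<subseteq> V" if "C \<in> P" for C
    using P that by (auto simp: partition_on_def)
  have "\<exists>C\<in>P. speaker S t \<in> C" for t
    using P speaker[of t] by (auto simp: partition_on_def)
  then obtain sp where sp: "\<And>t. sp t \<in> P" "\<And>t. speaker S t \<in> sp t" by metis
  have "\<forall>t. \<exists>st. AE \<omega> in N. history n S (Suc t) \<omega> = st (history n S t \<omega>) (\<lambda>j\<in>?B (sp t). Y j \<omega>)"
  proof
    fix t
    show "\<exists>st. AE \<omega> in N. history n S (Suc t) \<omega> = st (history n S t \<omega>) (\<lambda>j\<in>?B (sp t). Y j \<omega>)"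
      by (rule exI, rule step_from_block) (use sp(2)[of t] in auto)
  qed
  from choice[OF this] obtain st where
    st: "\<And>t. AE \<omega> in N. history n S (Suc t) \<omega> = st t (history n S t \<omega>) (\<lambda>j\<in>?B (sp t). Y j \<omega>)" by blast
  have "(real (card P) - real p) *
      (ent b N (\<lambda>\<omega>. (key \<omega>, history n S t \<omega>)) - ent b N (history n S t) - ent b N (\<lambda>\<omega>. \<lambda>j\<in>?J0. Y j \<omega>))
    \<le> (real p - 1) * ent b N (history n S t) + real (card P) * ?\<epsilon>"
  proof (rule N.secret_key_bound[where J="V <+> E \<times> {..<n}" and Y=Y and B="?B" and sp=sp and st=st
        and hist="history n S" and t=t and ?J0.0="?J0" and K=key and p=p and \<epsilon>="?\<epsilon>" and P=P and ?h0.0="[]" and pr="\<lambda>_. butlast"])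
    show "finite (V <+> E \<times> {..<n})" using finite_V finite_E by simp
    show "?J0 \<subseteq> ?B C \<and> ?B C \<subseteq> V <+> E \<times> {..<n}" if "C \<in> P" for C
      using blocks[OF that] by auto
    show "card {C\<in>P. j \<in> ?B C} \<le> p" if "j \<in> (V <+> E \<times> {..<n}) - ?J0" for j
    proof (cases j)
      case (Inl i)
      \<comment> \<open>The blocks are disjoint, so at most one of them contains user i; the bound p
        \<ge> 1 covers this.\<close>
      have "card {C\<in>P. j \<in> ?B C} \<le> card {the_elem {C\<in>P. i \<in> C}}"
      proof (intro card_mono subsetI)
        fix C assume C: "C \<in> {C\<in>P. j \<in> ?B C}"
        then have "{C\<in>P. i \<in> C} = {C}"
          using P Inl by (auto simp: partition_on_def disjoint_def)
        then show "C \<in> {the_elem {C\<in>P. i \<in> C}}" by simp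
      qed simp
      then show ?thesis using p by simp
    next
      case (Inr es)
      obtain e s where es: "es = (e, s)" by fastforce
      have "{C\<in>P. j \<in> ?B C} \<subseteq> {C\<in>P. C \<inter> \<xi> e \<noteq> {}}" using Inr es by auto
      then have "card {C\<in>P. j \<in> ?B C} \<le> card {C\<in>P. C \<inter> \<xi> e \<noteq> {}}"
        using fP by (intro card_mono) auto
      also have "\<dots> \<le> p" using that Inr es by (intro cover) auto
      finally show ?thesis .
    qed
    show "ent b N (\<lambda>\<omega>. (key \<omega>, history n S t \<omega>, \<lambda>j\<in>?B C. Y j \<omega>))
      \<le> ent b N (\<lambda>\<omega>. (history n S t \<omega>, \<lambda>j\<in>?B C. Y j \<omega>)) + ?\<epsilon>" if C: "C \<in> P" for C
    proof -
      obtain i where i: "i \<in> C" "i \<in> V" using blocks[OF C] by blast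
      have "\<exists>g. N.prob {\<omega>\<in>space N. key \<omega> \<noteq> g (history n S t \<omega>, \<lambda>j\<in>?B C. Y j \<omega>)} \<le> error_prob V n S"
        by (rule decode_from_block[OF i(2) _ _ t]) (use i in auto)
      then obtain g where
        g: "N.prob {\<omega>\<in>space N. key \<omega> \<noteq> g (history n S t \<omega>, \<lambda>j\<in>?B C. Y j \<omega>)} \<le> error_prob V n S" by blast
      have W: "simple_function N (\<lambda>\<omega>. (history n S t \<omega>, \<lambda>j\<in>?B C. Y j \<omega>))"
        using blocks[OF C] finite_V finite_E
        by (intro simple_function_Pair simple_history N.simple_function_restrict simple_Y)
          (auto intro: finite_subset)
      have K: "key ` space N \<subseteq> key_alphabet S" by (auto simp: space_N key_eq)
      \<comment> \<open>Only an upper bound on the error probability is at hand, so its factor log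
        |K| must be nonnegative.\<close>
      have "key_alphabet S \<noteq> {}" using K N.not_empty by auto
      then have "0 \<le> log b (real (card (key_alphabet S)))"
        using finite_keys base by (simp add: Suc_le_eq card_gt_0_iff)
      then have "N.prob {\<omega>\<in>space N. key \<omega> \<noteq> g (history n S t \<omega>, \<lambda>j\<in>?B C. Y j \<omega>)} * log b (real (card (key_alphabet S)))
        \<le> error_prob V n S * log b (real (card (key_alphabet S)))"
        using g by (intro mult_right_mono)
      with N.fano_inequality[OF simple_key W finite_keys K, of g] show ?thesis by linarith
    qed
  qed (fact fP p sp st Y_independent simple_Y simple_history simple_key | simp)+
  moreover have "(real (card P) - real p) * (cond_ent b N key F - real n * ent b PZ (\<lambda>z. \<lambda>e\<in>?E0. x e z))
    \<le> (real (card P) - real p) *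
      (ent b N (\<lambda>\<omega>. (key \<omega>, history n S t \<omega>)) - ent b N (history n S t) - ent b N (\<lambda>\<omega>. \<lambda>j\<in>?J0. Y j \<omega>))"
  proof (intro mult_left_mono)
    let ?f = "\<lambda>h. the_inv_into (disc_alphabet S) (\<lambda>f. map f [0..<t]) h"
    \<comment> \<open>The prefix and the discussion are functions of each other, so either may stand
      for the other in the entropies below.\<close>
    have f: "F \<omega> = ?f (history n S t \<omega>)" if "\<omega> \<in> space N" for \<omega>
      unfolding history_eq by (rule the_inv_into_f_f[OF t disc[OF that], symmetric])
    have "cond_ent b N key F = ent b N (\<lambda>\<omega>. (key \<omega>, F \<omega>)) - ent b N F"
      by (rule N.conditional_entropy_eq_diff[OF simple_key simple_discussion])
    moreover have "ent b N (\<lambda>\<omega>. (key \<omega>, F \<omega>)) \<le> ent b N (\<lambda>\<omega>. (key \<omega>, history n S t \<omega>))"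
      by (rule N.entropy_mono[where f="\<lambda>(c, h). (c, ?f h)"])
         (auto intro!: simple_function_Pair simple_key simple_discussion simple_history f)
    moreover have "ent b N (history n S t) \<le> ent b N F"
      by (rule N.entropy_mono[where f="\<lambda>f. map f [0..<t]"])
         (auto intro!: simple_discussion simple_history history_eq)
    ultimately show "cond_ent b N key F - real n * ent b PZ (\<lambda>z. \<lambda>e\<in>?E0. x e z)
      \<le> ent b N (\<lambda>\<omega>. (key \<omega>, history n S t \<omega>)) - ent b N (history n S t) - ent b N (\<lambda>\<omega>. \<lambda>j\<in>?J0. Y j \<omega>)"
      using common_entropy_le[OF E0] by linarith
    show "0 \<le> real (card P) - real p" using p by simp
  qed
  moreover have "(real p - 1) * ent b N (history n S t) \<le> (real p - 1) * log b (real (card (disc_alphabet S)))"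
  proof (intro mult_left_mono)
    have "ent b N (history n S t) \<le> ent b N F"
      by (rule N.entropy_mono[where f="\<lambda>f. map f [0..<t]"])
         (auto intro!: simple_discussion simple_history history_eq)
    also have "\<dots> \<le> log b (real (card (disc_alphabet S)))"
      using disc by (intro N.entropy_le_log_card simple_discussion finite_disc) auto
    finally show "ent b N (history n S t) \<le> log b (real (card (disc_alphabet S)))" .
  qed (use p in simp)
  ultimately show ?thesis by linarith
qed

end

section \<open>Limits of the rates\<close>

text \<open>A nonempty edge meets some block of the cover, so the maximum is at least 1. When every
  edge equals \<open>V\<close>, the value p = 1 reproduces the convention that \<alpha> is
  0.\<close>

lemma alpha_eq_overlap:
  assumes "finite E" "finite P" "P \<noteq> {}" "\<Union>P = V"
    and \<xi>: "\<And>e. e \<in> E \<Longrightarrow> \<xi> e \<subseteq> V \<and> \<xi> e \<noteq> {}"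
  obtains p :: nat where "1 \<le> p" "p \<le> card P"
    "\<And>e. e \<in> E \<Longrightarrow> \<xi> e \<noteq> V \<Longrightarrow> card {C\<in>P. C \<inter> \<xi> e \<noteq> {}} \<le> p"
    "alpha V E \<xi> P = (real p - 1) / (real (card P) - 1)"
proof (cases "{e\<in>E. \<xi> e \<noteq> V} = {}")
  case True
  have "1 \<le> card P" using assms by (simp add: Suc_le_eq card_gt_0_iff)
  then show thesis using True by (intro that[of 1]) (auto simp: alpha_def)
next
  case False
  let ?c = "\<lambda>e. card {C\<in>P. C \<inter> \<xi> e \<noteq> {}}"
  let ?M = "?c ` {e\<in>E. \<xi> e \<noteq> V}"
  have fin: "finite ?M" using assms by auto
  have "Max ?M \<in> ?M" using fin False by (intro Max_in) auto
  then obtain e where e: "e \<in> E" "Max ?M = ?c e" by auto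
  have "{C\<in>P. C \<inter> \<xi> e \<noteq> {}} \<noteq> {}" using \<xi>[OF e(1)] assms(4) by blast
  then have 1: "1 \<le> Max ?M" using assms(2) e(2) by (simp add: Suc_le_eq card_gt_0_iff)
  have 2: "Max ?M \<le> card P" unfolding e(2) using assms(2) by (intro card_mono) auto
  show thesis
  proof (rule that[OF 1 2])
    show "?c e \<le> Max ?M" if "e \<in> E" "\<xi> e \<noteq> V" for e using fin that by (intro Max_ge) auto
    show "alpha V E \<xi> P = (real (Max ?M) - 1) / (real (card P) - 1)"
      unfolding alpha_def if_not_P[OF False] ..
  qed
qed

text \<open>\<open>r\<close> may be unbounded, so \<open>err n * r n\<close> need not tend to 0. It
  is moved to the left, where it merely perturbs the coefficient 1 - \<alpha> of \<open>r n\<close>,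
  and the argument runs by contradiction at one large n.\<close>

lemma liminf_le_of_rate_inequality:
  fixes r d g err :: "nat \<Rightarrow> real" and \<alpha> R H \<kappa> :: real
  assumes \<alpha>: "0 \<le> \<alpha>" "\<alpha> < 1" and R: "0 \<le> R" and H: "0 \<le> H" and \<kappa>: "0 \<le> \<kappa>"
    and ineq: "\<And>n. 0 < n \<Longrightarrow> (1 - \<alpha>) * (r n - g n - H) \<le> \<alpha> * d n + \<kappa> * (c / real n + err n * r n)"
    and err: "err \<longlonglongrightarrow> 0" and g: "limsup (\<lambda>n. ereal (g n)) = 0" and d: "limsup (\<lambda>n. ereal (d n)) \<le> ereal R"
  shows "liminf (\<lambda>n. ereal (r n)) \<le> ereal (H + \<alpha> * R / (1 - \<alpha>))"
proof (rule ccontr)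
  define a where "a = H + \<alpha> * R / (1 - \<alpha>)"
  assume "\<not> ?thesis"
  then have "ereal a < liminf (\<lambda>n. ereal (r n))" by (simp add: a_def not_le)
  \<comment> \<open>The lower limit may be infinite; a point strictly below it and above a real
    number is real.\<close>
  from dense[OF this] obtain z where "ereal a < z" "z < liminf (\<lambda>n. ereal (r n))" by blast
  then obtain y where y: "a < y" "ereal y < liminf (\<lambda>n. ereal (r n))"
    by (cases z) auto
  have a: "0 \<le> a" unfolding a_def using \<alpha> R H by simp
  \<comment> \<open>The value at which the estimate below, evaluated at y in place of
    \<open>r n\<close>, becomes an equality; strictness then contradicts it. It also satisfies
    \<kappa> \<delta> < 1 - \<alpha>, which keeps the perturbed coefficient positive.\<close>
  define \<delta> where "\<delta> = (1 - \<alpha>) * (y - a) / (1 + \<kappa> + \<kappa> * y)"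
  have den: "0 < 1 + \<kappa> + \<kappa> * y" using \<kappa> a y by (intro add_pos_nonneg) auto
  have \<delta>: "0 < \<delta>" unfolding \<delta>_def using \<alpha> y den by simp
  have \<delta>eq: "\<delta> * (1 + \<kappa> + \<kappa> * y) = (1 - \<alpha>) * (y - a)" using den by (simp add: \<delta>_def)
  have "\<kappa> * (y - a) < 1 + \<kappa> + \<kappa> * y"
    using \<kappa> mult_nonneg_nonneg[OF \<kappa> a] by (simp add: right_diff_distrib)
  then have "(1 - \<alpha>) * (\<kappa> * (y - a)) < (1 - \<alpha>) * (1 + \<kappa> + \<kappa> * y)"
    using \<alpha> by (intro mult_strict_left_mono) auto
  then have \<kappa>\<delta>: "\<kappa> * \<delta> < 1 - \<alpha>"
    using den by (simp add: \<delta>_def divide_less_eq mult_ac)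
  have "eventually (\<lambda>n. ereal y < ereal (r n)) sequentially" by (rule less_LiminfD[OF y(2)])
  moreover have "eventually (\<lambda>n. ereal (g n) < ereal \<delta>) sequentially"
    using \<delta> by (intro Limsup_lessD) (simp add: g)
  moreover have "eventually (\<lambda>n. ereal (d n) < ereal (R + \<delta>)) sequentially"
    using \<delta> by (intro Limsup_lessD le_less_trans[OF d]) simp
  moreover have "eventually (\<lambda>n. err n < \<delta>) sequentially"
    by (rule order_tendstoD(2)[OF err \<delta>])
  moreover have "eventually (\<lambda>n. c / real n < \<delta>) sequentially"
    by (rule order_tendstoD(2)[OF lim_const_over_n \<delta>])
  moreover have "eventually (\<lambda>n. (0::nat) < n) sequentially" by (rule eventually_gt_at_top)
  ultimately have "eventually (\<lambda>n. y < r n \<and> g n < \<delta> \<and> d n < R + \<delta> \<and> err n < \<delta> \<and> c / real n < \<delta> \<and> 0 < n) sequentially"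
    by eventually_elim auto
  then obtain n where n: "y < r n" "g n < \<delta>" "d n < R + \<delta>" "err n < \<delta>" "c / real n < \<delta>" "0 < n"
    using eventually_happens'[OF sequentially_bot] by blast
  have "(1 - \<alpha>) * (r n - \<delta> - H) \<le> (1 - \<alpha>) * (r n - g n - H)"
    using n \<alpha> by (intro mult_left_mono) auto
  also have "\<dots> \<le> \<alpha> * d n + \<kappa> * (c / real n + err n * r n)" by (rule ineq[OF n(6)])
  \<comment> \<open>Replacing \<open>err n\<close> by \<delta> requires \<open>r n\<close> to be
    nonnegative, which follows from r n > y > a \<ge> 0.\<close>
  also have "\<dots> \<le> \<alpha> * (R + \<delta>) + \<kappa> * (\<delta> + \<delta> * r n)"
    using n \<alpha> \<kappa> a y by (intro add_mono mult_left_mono mult_right_mono) auto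
  finally have "(1 - \<alpha> - \<kappa> * \<delta>) * r n \<le> \<alpha> * R + (1 - \<alpha>) * H + \<delta> + \<kappa> * \<delta>"
    by (simp add: algebra_simps)
  moreover have "(1 - \<alpha> - \<kappa> * \<delta>) * y < (1 - \<alpha> - \<kappa> * \<delta>) * r n"
    using \<kappa>\<delta> n by (intro mult_strict_left_mono) auto
  moreover have "\<alpha> * R + (1 - \<alpha>) * H = (1 - \<alpha>) * a"
    unfolding a_def using \<alpha> by (simp add: distrib_left)
  ultimately have "(1 - \<alpha>) * y - (1 - \<alpha>) * a < \<delta> * (1 + \<kappa> + \<kappa> * y)"
    by (simp add: algebra_simps)
  then show False unfolding \<delta>eq by (simp add: right_diff_distrib)
qed

theorem lemma1:
  fixes b R :: real and m :: nat and M :: "'a measure"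
    and A :: "nat \<Rightarrow> 'z set" and Z :: "nat \<Rightarrow> 'a \<Rightarrow> 'z"
    and E :: "'e set" and \<xi> :: "'e \<Rightarrow> nat set" and X :: "'e \<Rightarrow> 'a \<Rightarrow> 'x"
    and P :: "nat set set"
  assumes "1 < b" and "2 \<le> m" and "prob_space M"
    and "\<And>i. i \<in> {1..m} \<Longrightarrow> finite (A i)"
    and "\<And>i. i \<in> {1..m} \<Longrightarrow> Z i \<in> measurable M (count_space (A i))"
    and "hypergraphical b M {1..m} Z E \<xi> X"
    and "partition_on {1..m} P" and "2 \<le> card P"
    and "0 \<le> R"
  shows "ereal (alpha {1..m} E \<xi> P) * ereal R \<ge>
    ereal (1 - alpha {1..m} E \<xi> P) *
      (secrecy_capacity b {1..m} A (source_law {1..m} A M Z) R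
        - ereal (ent b M (\<lambda>\<omega>. \<lambda>e\<in>{e\<in>E. \<xi> e = {1..m}}. X e \<omega>)))"
proof -
  let ?V = "{1..m}" and ?PZ = "source_law {1..m} A M Z"
  let ?H = "ent b M (\<lambda>\<omega>. \<lambda>e\<in>{e\<in>E. \<xi> e = {1..m}}. X e \<omega>)"
  define \<alpha> where "\<alpha> = alpha ?V E \<xi> P"
  obtain x :: "'e \<Rightarrow> (nat \<Rightarrow> 'z) \<Rightarrow> 'x" and k :: "nat \<Rightarrow> ('e \<Rightarrow> 'x) \<Rightarrow> 'z" and \<mu> where
    src: "edge_source b ?V A ?PZ E \<xi> x k \<mu>" and
    law: "\<And>E'. E' \<subseteq> E \<Longrightarrow> ent b ?PZ (\<lambda>z. \<lambda>e\<in>E'. x e z) = ent b M (\<lambda>\<omega>. \<lambda>e\<in>E'. X e \<omega>)"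
    using edge_source_law[OF assms(1,3) finite_atLeastAtMost assms(4,5,6)] by blast
  have fP: "finite P" "P \<noteq> {}" "\<Union>P = ?V"
    using assms(7,8) by (auto simp: partition_on_def intro: card_ge_0_finite)
  have E: "finite E" "\<And>e. e \<in> E \<Longrightarrow> \<xi> e \<subseteq> ?V \<and> \<xi> e \<noteq> {}"
    and X: "\<And>e. e \<in> E \<Longrightarrow> simple_function M (X e)"
    using assms(6) by (auto simp: hypergraphical_def)
  obtain p :: nat where p: "1 \<le> p" "p \<le> card P"
    and cover: "\<And>e. e \<in> E \<Longrightarrow> \<xi> e \<noteq> ?V \<Longrightarrow> card {C\<in>P. C \<inter> \<xi> e \<noteq> {}} \<le> p"
    and \<alpha>_eq: "\<alpha> = (real p - 1) / (real (card P) - 1)"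
    using alpha_eq_overlap[where \<xi>=\<xi>, OF E(1) fP E(2)] unfolding \<alpha>_def by blast
  have q: "0 < real (card P) - 1" using assms(8) by simp
  have \<alpha>: "0 \<le> \<alpha>" "\<alpha> \<le> 1" using p q by (simp_all add: \<alpha>_eq divide_le_eq)
  interpret M: information_space M b
    using assms(3,1) by (intro information_space.intro information_space_axioms.intro)
  have H: "0 \<le> ?H"
    using E X by (intro M.entropy_nonneg M.simple_function_restrict) auto
  show ?thesis
  proof (cases "\<alpha> = 1")
    \<comment> \<open>The factor of the capacity side is 0, and 0 times any extended real is 0; what
      remains is 0 \<le> R.\<close>
    case True
    then show ?thesis using assms(9) by (simp add: \<alpha>_def flip: zero_ereal_def)
  next
    case False
    with \<alpha> have \<alpha>1: "\<alpha> < 1" by simp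
    let ?\<kappa> = "real (card P) / (real (card P) - 1)"
    have "key_rate b S \<le> ereal (?H + \<alpha> * R / (1 - \<alpha>))"
      if S: "\<forall>n>0. is_scheme ?V A ?PZ n (S n)" "recoverable ?V S" "secret b S" "discussion_rate b S \<le> ereal R" for S
      unfolding key_rate_def
    proof (rule liminf_le_of_rate_inequality[OF \<alpha>(1) \<alpha>1 assms(9) H])
      show "0 \<le> ?\<kappa>" using q by simp
      show "(\<lambda>n. error_prob ?V n (S n)) \<longlonglongrightarrow> 0" using S(2) by (simp add: recoverable_def)
      show "limsup (\<lambda>n. ereal (1 / real n * (log b (real (card (key_alphabet (S n)))) -
        cond_ent b (joint_law (S n)) key (discussion n (S n))))) = 0"
        using S(3) by (simp add: secret_def)
      show "limsup (\<lambda>n. ereal (1 / real n * log b (real (card (disc_alphabet (S n)))))) \<le> ereal R"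
        using S(4) by (simp add: discussion_rate_def)
      fix n :: nat assume n: "0 < n"
      interpret edge_scheme b ?V A ?PZ E \<xi> x k \<mu> n "S n"
        using src S(1) n by (intro edge_scheme.intro edge_scheme_axioms.intro) auto
      let ?h = "cond_ent b (joint_law (S n)) key (discussion n (S n))"
      let ?K = "log b (real (card (key_alphabet (S n))))" and ?D = "log b (real (card (disc_alphabet (S n))))"
      let ?err = "error_prob ?V n (S n)"
      have "(real (card P) - real p) * (?h - real n * ?H)
        \<le> (real p - 1) * ?D + real (card P) * (log b 2 + ?err * ?K)"
        using scheme_bound[OF assms(7) p cover] law[of "{e\<in>E. \<xi> e = ?V}"] by simp
      \<comment> \<open>Division by n (|P| - 1) produces the coefficients (|P| - p) / (|P| - 1) = 1
        - \<alpha> and (p - 1) / (|P| - 1) = \<alpha>.\<close>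
      then have "(real (card P) - real p) * (?h - real n * ?H) / (real n * (real (card P) - 1))
        \<le> ((real p - 1) * ?D + real (card P) * (log b 2 + ?err * ?K)) / (real n * (real (card P) - 1))"
        using n q by (intro divide_right_mono) auto
      \<comment> \<open>H(K | F) / n is split into the key rate minus the secrecy defect, the
        quantities whose limits are controlled.\<close>
      also have "(real (card P) - real p) * (?h - real n * ?H) / (real n * (real (card P) - 1)) =
        (1 - \<alpha>) * (1 / real n * ?K - 1 / real n * (?K - ?h) - ?H)"
        using n q by (simp add: \<alpha>_eq field_simps)
      also have "((real p - 1) * ?D + real (card P) * (log b 2 + ?err * ?K)) / (real n * (real (card P) - 1)) =
        \<alpha> * (1 / real n * ?D) + ?\<kappa> * (log b 2 / real n + ?err * (1 / real n * ?K))"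
        unfolding \<alpha>_eq by (simp add: add_divide_distrib distrib_left mult_ac)
      finally show "(1 - \<alpha>) * (1 / real n * ?K - 1 / real n * (?K - ?h) - ?H)
        \<le> \<alpha> * (1 / real n * ?D) + ?\<kappa> * (log b 2 / real n + ?err * (1 / real n * ?K))" .
    qed
    \<comment> \<open>The bound is the capacity value for which the claim is an equality. It is
      finite, so subtracting the finite H(G) and scaling by 1 - \<alpha> > 0 lead back to the
      claim.\<close>
    then have "secrecy_capacity b ?V A ?PZ R \<le> ereal (?H + \<alpha> * R / (1 - \<alpha>))"
      unfolding secrecy_capacity_def by (intro Sup_least) blast
    then have "secrecy_capacity b ?V A ?PZ R - ereal ?H \<le> ereal (?H + \<alpha> * R / (1 - \<alpha>)) - ereal ?H"
      by (intro ereal_minus_mono) auto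
    then have "ereal (1 - \<alpha>) * (secrecy_capacity b ?V A ?PZ R - ereal ?H)
      \<le> ereal (1 - \<alpha>) * (ereal (?H + \<alpha> * R / (1 - \<alpha>)) - ereal ?H)"
      using \<alpha>1 by (intro ereal_mult_left_mono) auto
    also have "\<dots> = ereal \<alpha> * ereal R" using \<alpha>1 by simp
    finally show ?thesis unfolding \<alpha>_def .
  qed
qed

end
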